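(* Let $K_{15}$ be the middle-$15$th Cantor set and $\mu=\mu_{15}$ its Cantor–Lebesgue measure. (1) If $\psi:\mathbb{N}\to(0,1]$ is non-increasing and $\sum_q\psi(q)<\infty$, then $\mu(W(\psi,\gamma))=0$ for all $\gamma\in\mathbb{R}$. (2) There is a number $c>0$ such that for all $\nu\in(1,1+c)$ and all $\gamma\in\mathbb{R}$, with $\psi(q)=q^{-\nu}$, \[ \dim_{\mathrm{H}}(K_{15}\cap W(\psi,\gamma))\le \frac{2}{\nu+1}+\dim_{\mathrm{H}} K_{15}-1. \]
   Context: For $x\in\mathbb{R}$, $\|x\|$ denotes the distance from $x$ to $\mathbb{Z}$. For $\psi:\mathbb{N}\to(0,1]$ and $\gamma\in\mathbb{R}$, $W(\psi,\gamma)=\{x\in\mathbb{R}:\|qx-\gamma\|\le\psi(q)\text{ for infinitely many }q\in\mathbb{N}\}$. The middle-$15$th Cantor measure $\mu_{15}$ is the law of $\sum_{j\ge1}a_j15^{-j}$ with $a_j$ i.i.d. uniform on $\{0,\dots,14\}\setminus\{7\}$, and $K_{15}=\mathrm{supp}(\mu_{15})$. *)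

theory Defs
  imports "HOL-Probability.Probability"
begin

text \<open>
  The contribution of a covering set to the \<open>s\<close>-dimensional Hausdorff measure. Nonempty sets
  contribute \<open>(diam U)^s\<close> with the convention \<open>0^0 = 1\<close> (in HOL, \<open>0 powr 0 = 0\<close>), and the empty
  set contributes \<open>0\<close>.
\<close>

definition hausdorff_gauge :: "real \<Rightarrow> 'a::metric_space set \<Rightarrow> ennreal" where
  "hausdorff_gauge s U =
     (if U = {} then 0 else if s = 0 then 1 else ennreal (diameter U powr s))"

text \<open>
  Covering sets are required to be bounded because \<^const>\<open>diameter\<close> is unspecified on unbounded sets.
\<close>

definition hausdorff_premeasure :: "real \<Rightarrow> real \<Rightarrow> 'a::metric_space set \<Rightarrow> ennreal" where
  "hausdorff_premeasure s \<delta> A =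
     (INF U \<in> {U :: nat \<Rightarrow> 'a set. A \<subseteq> (\<Union>i. U i) \<and> (\<forall>i. bounded (U i) \<and> diameter (U i) \<le> \<delta>)}.
        \<Sum>i. hausdorff_gauge s (U i))"

definition hausdorff_measure :: "real \<Rightarrow> 'a::metric_space set \<Rightarrow> ennreal" where
  "hausdorff_measure s A = (SUP \<delta> \<in> {0<..}. hausdorff_premeasure s \<delta> A)"

definition hausdorff_dim :: "'a::metric_space set \<Rightarrow> ereal" where
  "hausdorff_dim A = (INF s \<in> {s. 0 \<le> s \<and> hausdorff_measure s A = 0}. ereal s)"

definition measure_support :: "'a::topological_space measure \<Rightarrow> 'a set" where
  "measure_support M = {x. \<forall>U. open U \<longrightarrow> x \<in> U \<longrightarrow> emeasure M U > 0}"

text \<open>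
  The digit sequence is indexed from \<open>0\<close>, so that \<open>a j\<close> is the digit at position \<open>j + 1\<close>.
\<close>

definition cantor15_measure :: "real measure" where
  "cantor15_measure =
     distr (Pi\<^sub>M (UNIV :: nat set) (\<lambda>_. measure_pmf (pmf_of_set ({0..14} - {7 :: nat})))) borel
       (\<lambda>a. \<Sum>j. real (a j) / 15 ^ Suc j)"

definition cantor15_set :: "real set" where
  "cantor15_set = measure_support cantor15_measure"

text \<open>
  Approximation functions live on the positive integers; their value at \<open>0\<close> plays no role.
\<close>

definition approximable_set :: "(nat \<Rightarrow> real) \<Rightarrow> real \<Rightarrow> real set" where
  "approximable_set \<psi> \<gamma> =
     {x. infinite {q :: nat. 1 \<le> q \<and> infdist (real q * x - \<gamma>) \<int> \<le> \<psi> q}}"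

end

theory Submission
  imports Defs "HOL-Computational_Algebra.Primes"
begin

text \<open>
  Let $E_N(n) = \sum_a e(na/15^N)$, the sum ranging over the $14^N$ integers $a < 15^N$ without the
  digit $7$. It factorises over the digits, so summing over one digit of $n$ at a time gives
  $\sum_{n<15^N} |E_N(n)| \le \Lambda^N$, where $\Lambda$ bounds the sum of the one-digit factor over
  the $15$ points $t + i/15$. Parseval alone gives $\Lambda^2 = 15 \cdot 14 \cdot 15$, which is too large; as the point
  nearest to an integer contributes more than its share, one may take $\Lambda = 107/2$, and the decisive
  inequality $\Lambda < 14 \sqrt{15}$ holds.

  Majorising the condition $\|qx - \gamma\| \le \delta$ by a Fejer kernel of degree about $1/\delta$
  and summing over $q \le Q$, every frequency $n$ is hit at most $d(n) \ll n^\epsilon$ times. With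
  $15^N \approx Q/\delta$ the nonzero frequencies therefore contribute no more than the zero frequency,
  as long as $\delta \ge Q^{-\nu_0}$ for some $\nu_0 > 1$, so that at most $O(14^N Q \delta)$ of the level-$N$
  intervals contain a solution for some $q \le Q$. Applied to dyadic ranges of $q$, this count yields the first claim by
  Borel--Cantelli, and an efficient cover for the second; the mass distribution principle bounds
  $\dim_H K_{15}$ from below by $\log 14 / \log 15$.
\<close>

section \<open>The divisor bound\<close>

text \<open>Every divisor splits as \<open>p ^ i * e\<close> with \<open>i \<le> a\<close> and
  \<open>e dvd m\<close>. Splittings may coincide when \<open>p\<close> divides \<open>m\<close>,
  hence only an inequality.\<close>

lemma card_divisors_prime_power_mult_le:
  fixes p a m :: nat
  assumes "prime p" "0 < m"
  shows "card {d. d dvd p ^ a * m} \<le> Suc a * card {d. d dvd m}"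
proof -
  have "{d. d dvd p ^ a * m} \<subseteq> (\<lambda>(i, e). p ^ i * e) ` ({..a} \<times> {e. e dvd m})"
  proof
    fix d assume "d \<in> {d. d dvd p ^ a * m}"
    then obtain b e where be: "d = b * e" "b dvd p ^ a" "e dvd m"
      by (auto dest: division_decomp)
    then obtain i where "i \<le> a" "b = p ^ i"
      using assms(1) divides_primepow_nat by blast
    with be show "d \<in> (\<lambda>(i, e). p ^ i * e) ` ({..a} \<times> {e. e dvd m})"
      by (auto intro!: image_eqI[of _ _ "(i, e)"])
  qed
  then have "card {d. d dvd p ^ a * m} \<le> card ({..a} \<times> {e. e dvd m})"
    using assms(2) by (intro surj_card_le) auto
  then show ?thesis by (simp add: card_cartesian_product)
qed

lemma divisor_bound:
  fixes \<epsilon> :: real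
  assumes "0 < \<epsilon>"
  shows "\<exists>C>0. \<forall>n\<ge>1. real (card {d. d dvd n}) \<le> C * real n powr \<epsilon>"
proof -
  \<comment> \<open>The entry \<open>1 / (\<epsilon> * ln 2)\<close> gives
    \<open>a \<le> K * (a * \<epsilon> * ln 2)\<close>, after which \<open>1 + x \<le> exp x\<close>
    applies. The entry 1 absorbs the remaining summand 1 and makes the powers of \<open>K\<close>
    increasing.\<close>
  define K where "K = max 1 (1 / (\<epsilon> * ln 2))"
  \<comment> \<open>Threshold from which \<open>p powr \<epsilon> \<ge> 2\<close>, so that
    \<open>a + 1 \<le> 2 ^ a\<close> suffices.\<close>
  define B where "B = nat \<lceil>2 powr (1 / \<epsilon>)\<rceil>"
  have K1: "1 \<le> K" by (simp add: K_def)
  have K: "real (Suc a) \<le> K * real (p ^ a) powr \<epsilon>" if "2 \<le> p" for a p :: nat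
  proof -
    have pos: "0 < \<epsilon> * ln 2" using assms by simp
    have "1 / (\<epsilon> * ln 2) * (\<epsilon> * ln 2) \<le> K * (\<epsilon> * ln 2)"
      using pos by (intro mult_right_mono) (auto simp: K_def)
    moreover have "1 / (\<epsilon> * ln 2) * (\<epsilon> * ln 2) = 1" using pos assms by simp
    ultimately have "1 \<le> K * (\<epsilon> * ln 2)" by linarith
    then have "real a * 1 \<le> real a * (K * (\<epsilon> * ln 2))" by (intro mult_left_mono) auto
    then have "real (Suc a) \<le> K * (1 + real a * \<epsilon> * ln 2)"
      using K1 by (simp add: algebra_simps)
    also have "\<dots> \<le> K * exp (real a * \<epsilon> * ln 2)"
      using K1 exp_ge_add_one_self by (intro mult_left_mono) auto
    also have "exp (real a * \<epsilon> * ln 2) = (2 powr real a) powr \<epsilon>"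
      by (simp add: powr_def mult_ac)
    also have "\<dots> \<le> real (p ^ a) powr \<epsilon>"
      using assms that by (intro powr_mono2) (auto simp: powr_realpow intro: power_mono)
    finally show ?thesis using K1 by simp
  qed
  have big: "real (Suc a) \<le> real (p ^ a) powr \<epsilon>" if "B \<le> p" for a p :: nat
  proof -
    have "2 powr (1 / \<epsilon>) \<le> real p" using that unfolding B_def by linarith
    then have "(2 powr (1 / \<epsilon>)) powr \<epsilon> \<le> real p powr \<epsilon>"
      using assms by (intro powr_mono2) auto
    then have "2 \<le> real p powr \<epsilon>" using assms by (simp add: powr_powr)
    then have "2 ^ a \<le> (real p powr \<epsilon>) ^ a" by (intro power_mono) auto
    also have "\<dots> = real (p ^ a) powr \<epsilon>"
      by (cases "p = 0"; cases "a = 0")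
        (use \<open>2 \<le> real p powr \<epsilon>\<close> in \<open>auto simp: powr_powr mult_ac simp flip: powr_realpow\<close>)
    moreover have "Suc a \<le> 2 ^ a" by (induction a) auto
    then have "real (Suc a) \<le> 2 ^ a"
      by (metis of_nat_le_iff of_nat_numeral of_nat_power)
    ultimately show ?thesis by linarith
  qed
  \<comment> \<open>Each induction step strips the full power of one prime. The exponent of
    \<open>K\<close> counts the small prime divisors of \<open>n\<close>, so a step spends a factor
    \<open>K\<close> only when the stripped prime is below \<open>B\<close>.\<close>
  have main: "real (card {d. d dvd n}) \<le> K ^ card {p. prime p \<and> p < B \<and> p dvd n} * real n powr \<epsilon>"
    if "1 \<le> n" for n
    using that
  proof (induction n rule: less_induct)
    case (less n)
    show ?case
    proof (cases "n = 1")
      case True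
      with K1 show ?thesis by simp
    next
      case False
      then obtain p where p: "prime p" "p dvd n" using prime_factor_nat by blast
      define a where "a = multiplicity p n"
      from p less.prems obtain m where m: "n = p ^ a * m" "\<not> p dvd m"
        unfolding a_def by (metis multiplicity_decompose' not_one_le_zero not_prime_unit)
      have "a \<noteq> 0" using m p by (metis mult_1 power_0)
      then have pa: "1 < p ^ a" using prime_gt_1_nat[OF p(1)] by (metis one_less_power neq0_conv)
      have m0: "1 \<le> m" using m by (cases m) auto
      have mn: "m < n" using m pa m0 by simp
      let ?S = "\<lambda>n. {p. prime p \<and> p < B \<and> p dvd n}"
      have fin: "finite (?S n)" by (rule finite_subset[of _ "{..<B}"]) auto
      have sub: "?S m \<subseteq> ?S n" using m by auto
      have "real (card {d. d dvd n}) \<le> real (Suc a * card {d. d dvd m})"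
        unfolding m(1) using card_divisors_prime_power_mult_le[OF p(1)] m0
        by (metis less_eq_Suc_le of_nat_mono One_nat_def)
      also have "\<dots> = real (Suc a) * real (card {d. d dvd m})" by (simp add: algebra_simps)
      also have "\<dots> \<le> real (Suc a) * (K ^ card (?S m) * real m powr \<epsilon>)"
        using less.IH[OF mn m0] by (intro mult_left_mono) auto
      also have "\<dots> \<le> K ^ card (?S n) * real n powr \<epsilon>"
      proof (cases "p < B")
        case True
        have "insert p (?S m) \<subseteq> ?S n" using sub p True by auto
        then have "card (insert p (?S m)) \<le> card (?S n)" using fin by (rule card_mono[rotated])
        moreover have "card (insert p (?S m)) = Suc (card (?S m))"
          using m finite_subset[OF sub fin] by simp
        ultimately have le: "K ^ Suc (card (?S m)) \<le> K ^ card (?S n)"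
          using K1 by (intro power_increasing) auto
        have "real (Suc a) * (K ^ card (?S m) * real m powr \<epsilon>)
            \<le> (K * real (p ^ a) powr \<epsilon>) * (K ^ card (?S m) * real m powr \<epsilon>)"
          using K[of p a] p prime_ge_2_nat K1 by (intro mult_right_mono) auto
        also have "\<dots> = K ^ Suc (card (?S m)) * real n powr \<epsilon>"
          by (simp add: m(1) powr_mult)
        also have "\<dots> \<le> K ^ card (?S n) * real n powr \<epsilon>"
          using le by (intro mult_right_mono) auto
        finally show ?thesis .
      next
        case False
        have le: "K ^ card (?S m) \<le> K ^ card (?S n)"
          using K1 card_mono[OF fin sub] by (intro power_increasing) auto
        have "real (Suc a) * (K ^ card (?S m) * real m powr \<epsilon>)
            \<le> (real (p ^ a) powr \<epsilon>) * (K ^ card (?S m) * real m powr \<epsilon>)"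
          using big[of p a] False K1 by (intro mult_right_mono) auto
        also have "\<dots> = K ^ card (?S m) * real n powr \<epsilon>"
          by (simp add: m(1) powr_mult)
        also have "\<dots> \<le> K ^ card (?S n) * real n powr \<epsilon>"
          using le by (intro mult_right_mono) auto
        finally show ?thesis .
      qed
      finally show ?thesis .
    qed
  qed
  have "real (card {d. d dvd n}) \<le> K ^ B * real n powr \<epsilon>" if "1 \<le> n" for n
  proof -
    have "card {p. prime p \<and> p < B \<and> p dvd n} \<le> card {..<B}" by (intro card_mono) auto
    then have "K ^ card {p. prime p \<and> p < B \<and> p dvd n} \<le> K ^ B"
      using K1 by (intro power_increasing) auto
    then have "K ^ card {p. prime p \<and> p < B \<and> p dvd n} * real n powr \<epsilon> \<le> K ^ B * real n powr \<epsilon>"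
      by (intro mult_right_mono) auto
    with main[OF that] show ?thesis by linarith
  qed
  moreover have "0 < K ^ B" using K1 by simp
  ultimately show ?thesis by blast
qed

section \<open>Exponential sums over integers with restricted digits\<close>

definition cantor15_digits :: "nat set" where
  "cantor15_digits = {0..14} - {7}"

text \<open>Digits are appended at the low end, so the intervals of level \<open>N + 1\<close>
  refine those of level \<open>N\<close>. Leading zeros are allowed.\<close>

fun cantor15_ints :: "nat \<Rightarrow> nat set" where
  "cantor15_ints 0 = {0}"
| "cantor15_ints (Suc N) = (\<lambda>(a, d). 15 * a + d) ` (cantor15_ints N \<times> cantor15_digits)"

lemma finite_cantor15_digits [simp]: "finite cantor15_digits"
  and card_cantor15_digits [simp]: "card cantor15_digits = 14"
  and cantor15_digits_less: "d \<in> cantor15_digits \<Longrightarrow> d < 15"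
  by (auto simp: cantor15_digits_def)

lemma finite_cantor15_ints [simp]: "finite (cantor15_ints N)"
  by (induction N) auto

lemma inj_on_base15: "inj_on (\<lambda>(a, d). 15 * a + d) (X \<times> cantor15_digits)"
proof (rule inj_onI, clarify)
  fix a d a' d' assume "d \<in> cantor15_digits" "d' \<in> cantor15_digits" "15 * a + d = 15 * a' + d'"
  moreover have "(15 * b + e) mod 15 = e" if "e \<in> cantor15_digits" for b e :: nat
    using cantor15_digits_less[OF that] by simp
  ultimately have "d = d'" by metis
  with \<open>15 * a + d = 15 * a' + d'\<close> show "a = a' \<and> d = d'" by simp
qed

lemma card_cantor15_ints [simp]: "card (cantor15_ints N) = 14 ^ N"
  by (induction N) (auto simp: card_image[OF inj_on_base15] card_cartesian_product)

definition cantor15_esum :: "nat \<Rightarrow> real \<Rightarrow> complex" where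
  "cantor15_esum N t = (\<Sum>a\<in>cantor15_ints N. cis (2 * pi * t * real a / 15 ^ N))"

definition digit_esum :: "real \<Rightarrow> complex" where
  "digit_esum t = (\<Sum>d\<in>cantor15_digits. cis (2 * pi * t * real d))"

text \<open>As \<open>(15 a + d) / 15^(N+1) = a / 15^N + d / 15^(N+1)\<close>, the lowest digit
  splits off as a factor.\<close>

lemma cantor15_esum_Suc:
  "cantor15_esum (Suc N) t = cantor15_esum N t * digit_esum (t / 15 ^ Suc N)"
proof -
  have "cantor15_esum (Suc N) t
      = (\<Sum>(a, d)\<in>cantor15_ints N \<times> cantor15_digits. cis (2 * pi * t * real (15 * a + d) / 15 ^ Suc N))"
    unfolding cantor15_esum_def cantor15_ints.simps
    by (subst sum.reindex[OF inj_on_base15]) (auto simp: case_prod_unfold)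
  also have "\<dots> = (\<Sum>(a, d)\<in>cantor15_ints N \<times> cantor15_digits.
      cis (2 * pi * t * real a / 15 ^ N) * cis (2 * pi * (t / 15 ^ Suc N) * real d))"
    by (intro sum.cong) (auto simp: cis_mult field_simps)
  also have "\<dots> = cantor15_esum N t * digit_esum (t / 15 ^ Suc N)"
    by (simp add: cantor15_esum_def digit_esum_def sum_product sum.cartesian_product)
  finally show ?thesis .
qed

lemma norm_cantor15_esum_minus: "norm (cantor15_esum N (- t)) = norm (cantor15_esum N t)"
proof -
  have "cantor15_esum N (- t) = cnj (cantor15_esum N t)"
    by (simp add: cantor15_esum_def cis_cnj)
  then show ?thesis by simp
qed

section \<open>Periodicity and orthogonality of characters\<close>

lemma cis_2pi_int [simp]: "cis (2 * pi * real_of_int k) = 1"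
  by (metis cis_multiple_2pi Ints_of_int)

lemma cis_2pi_add_int: "cis (2 * pi * (x + real_of_int k)) = cis (2 * pi * x)"
  by (metis cis_2pi_int cis_mult distrib_left mult.right_neutral)

text \<open>The frequencies below \<open>15 ^ N\<close> form a full period; this separates the top
  digit of a frequency from the lower ones.\<close>

lemma cantor15_esum_periodic:
  "cantor15_esum N (t + 15 ^ N * real i) = cantor15_esum N t"
  unfolding cantor15_esum_def
proof (intro sum.cong refl)
  fix a
  have "2 * pi * (t + 15 ^ N * real i) * real a / 15 ^ N
      = 2 * pi * (t * real a / 15 ^ N + real_of_int (int (i * a)))"
    by (simp add: field_simps)
  then show "cis (2 * pi * (t + 15 ^ N * real i) * real a / 15 ^ N) = cis (2 * pi * t * real a / 15 ^ N)"
    by (simp only: cis_2pi_add_int) (simp add: mult.assoc)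
qed

text \<open>The shift \<open>t\<close> only contributes a common factor; what remains is a geometric
  sum whose ratio is an \<open>n\<close>-th root of unity, equal to 1 exactly when \<open>n\<close>
  divides \<open>m\<close>.\<close>

lemma sum_roots_of_unity_shift:
  fixes m :: int
  assumes "0 < n"
  shows "(\<Sum>i<n. cis (2 * pi * real_of_int m * (t + real i / real n)))
    = (if int n dvd m then of_nat n * cis (2 * pi * real_of_int m * t) else 0)"
proof -
  define z where "z = cis (2 * pi * (real_of_int m / real n))"
  have eq: "cis (2 * pi * real_of_int m * (t + real i / real n)) = cis (2 * pi * real_of_int m * t) * z ^ i" for i
    unfolding z_def Complex.DeMoivre cis_mult by (intro arg_cong[of _ _ cis]) (simp add: algebra_simps)
  have zn: "z ^ n = 1"
  proof -
    have "real n * (2 * pi * (real_of_int m / real n)) = 2 * pi * real_of_int m" using assms by simp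
    then show ?thesis unfolding z_def Complex.DeMoivre by (simp only: cis_2pi_int)
  qed
  show ?thesis
  proof (cases "int n dvd m")
    case True
    then obtain k where "m = int n * k" by blast
    then have "z = 1" using assms cis_2pi_int[of k] by (simp add: z_def)
    with True show ?thesis unfolding eq by simp
  next
    case False
    have "z \<noteq> 1"
    proof
      assume "z = 1"
      then have "cos (2 * pi * (real_of_int m / real n)) = 1"
        unfolding z_def by (metis cis.sel(1) one_complex.sel(1))
      then obtain k :: int where "2 * pi * (real_of_int m / real n) = real_of_int k * 2 * pi"
        using cos_one_2pi_int by blast
      then have "real_of_int m = real_of_int (k * int n)" using assms by (simp add: field_simps)
      then have "m = k * int n" by linarith
      with False show False by simp
    qed
    then have "(\<Sum>i<n. z ^ i) = 0" by (simp add: geometric_sum zn)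
    with False show ?thesis unfolding eq by (simp flip: sum_distrib_left)
  qed
qed

section \<open>The one-digit factor on a grid of 15 points\<close>

text \<open>Distinct digits differ by less than 15, so only the 14 diagonal pairs survive
  orthogonality, each with weight 15.\<close>

lemma digit_esum_parseval: "(\<Sum>i<15. (norm (digit_esum (t + real i / 15)))\<^sup>2) = 210"
proof -
  let ?D = cantor15_digits
  have "complex_of_real ((norm (digit_esum u))\<^sup>2)
      = (\<Sum>d\<in>?D. \<Sum>d'\<in>?D. cis (2 * pi * real_of_int (int d - int d') * u))" for u
  proof -
    have "complex_of_real ((norm (digit_esum u))\<^sup>2) = digit_esum u * cnj (digit_esum u)"
      by (rule complex_norm_square)
    also have "\<dots> = (\<Sum>d\<in>?D. \<Sum>d'\<in>?D. cis (2 * pi * u * real d) * cis (- (2 * pi * u * real d')))"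
      by (simp add: digit_esum_def sum_product cis_cnj)
    finally show ?thesis by (simp add: cis_mult algebra_simps)
  qed
  then have "complex_of_real (\<Sum>i<15. (norm (digit_esum (t + real i / 15)))\<^sup>2)
      = (\<Sum>i<15. \<Sum>d\<in>?D. \<Sum>d'\<in>?D. cis (2 * pi * real_of_int (int d - int d') * (t + real i / 15)))"
    by (simp add: of_real_sum)
  also have "\<dots> = (\<Sum>d\<in>?D. \<Sum>d'\<in>?D. \<Sum>i<15. cis (2 * pi * real_of_int (int d - int d') * (t + real i / 15)))"
    by (simp only: sum.swap[of _ _ "{..<15}"])
  also have "\<dots> = (\<Sum>d\<in>?D. \<Sum>d'\<in>?D. if d = d' then 15 else 0)"
  proof (intro sum.cong refl)
    fix d d' assume "d \<in> ?D" "d' \<in> ?D"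
    have "(15::int) dvd int d - int d' \<longleftrightarrow> d = d'"
    proof -
      have "\<bar>int d - int d'\<bar> < 15"
        using \<open>d \<in> ?D\<close> \<open>d' \<in> ?D\<close> cantor15_digits_less[of d] cantor15_digits_less[of d'] by linarith
      then show ?thesis using dvd_imp_le_int[of "int d - int d'" 15] by (cases "d = d'") auto
    qed
    then show "(\<Sum>i<15. cis (2 * pi * real_of_int (int d - int d') * (t + real i / 15)))
        = (if d = d' then 15 else 0)"
      using sum_roots_of_unity_shift[of 15 "int d - int d'" t] by auto
  qed
  also have "\<dots> = complex_of_real 210" by (simp add: sum.delta)
  finally show ?thesis using of_real_eq_iff by blast
qed

text \<open>The digit set is symmetric about the missing digit 7; pairing opposite digits later
  turns exponentials into cosines.\<close>

lemma sum_cantor15_digits: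
  "(\<Sum>d\<in>cantor15_digits. f d) = (\<Sum>k=1..7. f (7 + k) + f (7 - k))" for f :: "nat \<Rightarrow> 'a::comm_monoid_add"
proof -
  have "cantor15_digits = {8..<15} \<union> {..<7}" by (auto simp: cantor15_digits_def)
  then have "(\<Sum>d\<in>cantor15_digits. f d) = (\<Sum>d\<in>{8..<15}. f d) + (\<Sum>d\<in>{..<7}. f d)"
    by (subst sum.union_disjoint[symmetric]) auto
  also have "(\<Sum>d\<in>{8..<15}. f d) = (\<Sum>k=1..7. f (7 + k))"
    by (rule sum.reindex_bij_witness[of _ "\<lambda>k. 7 + k" "\<lambda>k. k - 7"]) auto
  also have "(\<Sum>d\<in>{..<7}. f d) = (\<Sum>k=1..7. f (7 - k))"
    by (rule sum.reindex_bij_witness[of _ "\<lambda>k. 7 - k" "\<lambda>k. 7 - k"]) auto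
  finally show ?thesis by (simp add: sum.distrib)
qed

text \<open>Rotating the sum by its central frequency 7 makes it a real sum of cosines, and each
  cosine is bounded below by \<open>1 - x^2 / 2\<close>.\<close>

lemma norm_digit_esum_near_int:
  fixes k :: int
  assumes "\<bar>t - real_of_int k\<bar> \<le> 1 / 30"
  shows "784 / 100 \<le> norm (digit_esum t)"
proof -
  define u where "u = t - real_of_int k"
  have per: "cis (2 * pi * t * real d) = cis (2 * pi * u * real d)" for d :: nat
  proof -
    have "2 * pi * t * real d = 2 * pi * (u * real d + real_of_int (k * int d))"
      by (simp add: u_def algebra_simps)
    then show ?thesis by (simp only: cis_2pi_add_int) (simp add: mult.assoc)
  qed
  \<comment> \<open>The square of \<open>2 * 3.1416 / 30\<close> is about 0.04387.\<close>
  have x2: "(2 * pi * u)\<^sup>2 \<le> (44 / 1000)"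
  proof -
    have "\<bar>2 * pi * u\<bar> \<le> 2 * 3.1416 * (1 / 30)"
      using assms pi_less_4 pi_approx unfolding u_def abs_mult by (intro mult_mono) auto
    then have "\<bar>2 * pi * u\<bar> ^ 2 \<le> (2 * 3.1416 * (1 / 30)) ^ 2" by (intro power_mono) auto
    then show ?thesis by (simp add: power2_eq_square)
  qed
  have c: "1 - (real j)\<^sup>2 * (22 / 1000) \<le> cos (2 * pi * u * real j)" for j :: nat
  proof -
    have "1 - (2 * pi * u * real j)\<^sup>2 / 2 \<le> cos (2 * pi * u * real j)"
    proof -
      have "cos (2 * pi * u * real j) = 1 - 2 * (sin (pi * u * real j))\<^sup>2"
        using cos_double_sin[of "pi * u * real j"] by (simp add: mult_ac)
      moreover have "(sin (pi * u * real j))\<^sup>2 \<le> (pi * u * real j)\<^sup>2"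
        using abs_sin_x_le_abs_x by (simp add: abs_le_square_iff)
      ultimately show ?thesis by (simp add: power_mult_distrib)
    qed
    moreover have "(2 * pi * u)\<^sup>2 * (real j)\<^sup>2 \<le> (44 / 1000) * (real j)\<^sup>2"
      using x2 by (intro mult_right_mono) auto
    ultimately show ?thesis by (simp add: power_mult_distrib mult_ac)
  qed
  have "cis (- (2 * pi * u * 7)) * digit_esum t
      = (\<Sum>j=1..7. cis (2 * pi * u * real j) + cis (- (2 * pi * u * real j)))"
    unfolding digit_esum_def per sum_cantor15_digits sum_distrib_left
    by (intro sum.cong refl) (auto simp: cis_mult distrib_left of_nat_diff algebra_simps)
  also have "Re \<dots> = (\<Sum>j=1..7. 2 * cos (2 * pi * u * real j))" by simp
  finally have *: "Re (cis (- (2 * pi * u * 7)) * digit_esum t) = (\<Sum>j=1..7. 2 * cos (2 * pi * u * real j))" .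
  \<comment> \<open>The squares of 1 to 7 add up to 140, so the left side is
    \<open>2 * (7 - 140 * 0.022) = 7.84\<close>.\<close>
  have "(\<Sum>j=1..7. 2 * (1 - (real j)\<^sup>2 * (22 / 1000))) \<le> (\<Sum>j=1..7. 2 * cos (2 * pi * u * real j))"
    using c by (intro sum_mono mult_left_mono) auto
  moreover have "(\<Sum>j=1..7. 2 * (1 - (real j)\<^sup>2 * (22 / 1000))) = 784 / 100"
    by (simp add: numeral_eq_Suc)
  ultimately have "784 / 100 \<le> Re (cis (- (2 * pi * u * 7)) * digit_esum t)" using * by simp
  also have "\<dots> \<le> norm (cis (- (2 * pi * u * 7)) * digit_esum t)" by (rule complex_Re_le_cmod)
  finally show ?thesis by (simp add: norm_mult)
qed

text \<open>Among the 15 grid points one lies within 1/30 of an integer and has a value of at least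
  7.84. Cauchy-Schwarz is applied to the other 14 only, with the square mass that Parseval leaves
  for them. This beats Cauchy-Schwarz on all 15 points.\<close>

lemma sum_norm_digit_esum_le: "(\<Sum>i<15. norm (digit_esum (t + real i / 15))) \<le> 107 / 2"
proof -
  define f where "f i = norm (digit_esum (t + real i / 15))" for i :: nat
  \<comment> \<open>\<open>15 * t + m\<close> lies within 1/2 of zero, so reducing \<open>m\<close>
    modulo 15 selects the grid point closest to an integer.\<close>
  define m where "m = - round (15 * t)"
  define i where "i = nat (m mod 15)"
  have i15: "i < 15" by (simp add: i_def nat_less_iff)
  have mi: "real_of_int m = real i + 15 * real_of_int (m div 15)"
  proof -
    have "m = int i + 15 * (m div 15)" by (simp add: i_def)
    then show ?thesis by (metis of_int_add of_int_mult of_int_numeral of_int_of_nat_eq)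
  qed
  have "\<bar>15 * t + real_of_int m\<bar> \<le> 1 / 2"
    using of_int_round_abs_le[of "15 * t"] by (simp add: m_def abs_minus_commute)
  then have "\<bar>t + real i / 15 - real_of_int (- (m div 15))\<bar> \<le> 1 / 30"
    using mi by (simp add: abs_if field_simps split: if_splits)
  then have t: "784 / 100 \<le> f i" unfolding f_def by (rule norm_digit_esum_near_int)
  let ?R = "{..<15} - {i}"
  have sq: "(\<Sum>j\<in>?R. (f j)\<^sup>2) = 210 - (f i)\<^sup>2"
    using digit_esum_parseval[of t] i15 unfolding f_def by (simp add: sum_diff1)
  have "(\<Sum>j\<in>?R. f j)\<^sup>2 \<le> (\<Sum>j\<in>?R. 1\<^sup>2) * (\<Sum>j\<in>?R. (f j)\<^sup>2)"
    using Cauchy_Schwarz_ineq_sum[of "\<lambda>_. 1" f ?R] by simp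
  also have "\<dots> = 14 * (210 - (f i)\<^sup>2)" using sq i15 by simp
  finally have S: "(\<Sum>j\<in>?R. f j)\<^sup>2 \<le> 14 * (210 - (f i)\<^sup>2)" .
  \<comment> \<open>Ensures that \<open>107 / 2 - f i\<close> is nonnegative when square roots are
    taken below.\<close>
  have "f i \<le> 15"
  proof -
    have "0 \<le> (\<Sum>j\<in>?R. (f j)\<^sup>2)" by (intro sum_nonneg) auto
    then have "(f i)\<^sup>2 \<le> 15\<^sup>2" using sq by simp
    then show ?thesis by (rule power2_le_imp_le) simp
  qed
  \<comment> \<open>With \<open>f\<close> for \<open>f i\<close>, the next inequality amounts to
    \<open>15 f^2 - 107 f \<ge> 77.75\<close>, while this product equals
    \<open>15 f^2 - 107 f - 83.104\<close>.\<close>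
  have "0 \<le> (f i - 784 / 100) * (15 * f i + 106 / 10)"
    using t by (intro mult_nonneg_nonneg) auto
  then have "14 * (210 - (f i)\<^sup>2) \<le> (107 / 2 - f i)\<^sup>2"
    using t by (simp add: power2_eq_square algebra_simps)
  with S have "(\<Sum>j\<in>?R. f j)\<^sup>2 \<le> (107 / 2 - f i)\<^sup>2" by linarith
  then have "(\<Sum>j\<in>?R. f j) \<le> 107 / 2 - f i"
    by (rule power2_le_imp_le) (use \<open>f i \<le> 15\<close> in linarith)
  moreover have "(\<Sum>j<15. f j) = f i + (\<Sum>j\<in>?R. f j)"
    using i15 by (intro sum.remove) auto
  ultimately have "(\<Sum>j<15. f j) \<le> 107 / 2" by linarith
  then show ?thesis by (simp only: f_def)
qed

text \<open>Write a frequency as \<open>n + i * 15 ^ N\<close> with top digit \<open>i\<close>. By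
  periodicity the level-\<open>N\<close> factor depends on \<open>n\<close> alone, and for fixed
  \<open>n\<close> the remaining one-digit factors run over a grid of 15 points.\<close>

lemma sum_norm_cantor15_esum_le:
  "(\<Sum>n<15 ^ N. norm (cantor15_esum N (real n))) \<le> (107 / 2) ^ N"
proof (induction N)
  case 0
  then show ?case by (simp add: cantor15_esum_def)
next
  case (Suc N)
  have "(\<Sum>n<15 ^ Suc N. norm (cantor15_esum (Suc N) (real n)))
      = (\<Sum>i<15. \<Sum>n<15 ^ N. norm (cantor15_esum (Suc N) (real (n + i * 15 ^ N))))"
  proof -
    have "(\<Sum>n = i * 15 ^ N..<i * 15 ^ N + 15 ^ N. f n) = (\<Sum>n<15 ^ N. f (n + i * 15 ^ N))"
      for i and f :: "nat \<Rightarrow> real"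
      using sum.shift_bounds_nat_ivl[of f 0 "i * 15 ^ N" "15 ^ N"]
      by (simp add: add.commute atLeast0LessThan)
    then show ?thesis
      using sum.nat_group[of "\<lambda>n. norm (cantor15_esum (Suc N) (real n))" "15 ^ N" 15] by simp
  qed
  also have "\<dots> = (\<Sum>n<15 ^ N. \<Sum>i<15. norm (cantor15_esum (Suc N) (real (n + i * 15 ^ N))))"
    by (rule sum.swap)
  also have "\<dots> = (\<Sum>n<15 ^ N. norm (cantor15_esum N (real n)) *
      (\<Sum>i<15. norm (digit_esum (real n / 15 ^ Suc N + real i / 15))))"
  proof (intro sum.cong refl, unfold sum_distrib_left, intro sum.cong refl)
    fix n i
    have "real (n + i * 15 ^ N) / 15 ^ Suc N = real n / 15 ^ Suc N + real i / 15"
      by (simp add: field_simps)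
    moreover have "cantor15_esum N (real (n + i * 15 ^ N)) = cantor15_esum N (real n)"
      using cantor15_esum_periodic[of N "real n" i] by (simp add: mult.commute)
    ultimately show "norm (cantor15_esum (Suc N) (real (n + i * 15 ^ N)))
        = norm (cantor15_esum N (real n)) * norm (digit_esum (real n / 15 ^ Suc N + real i / 15))"
      by (simp only: cantor15_esum_Suc norm_mult)
  qed
  also have "\<dots> \<le> (\<Sum>n<15 ^ N. norm (cantor15_esum N (real n)) * (107 / 2))"
    by (intro sum_mono mult_left_mono sum_norm_digit_esum_le) auto
  also have "\<dots> \<le> (107 / 2) ^ N * (107 / 2)"
    unfolding sum_distrib_right[symmetric] using Suc by (intro mult_right_mono) auto
  finally show ?case by (simp add: mult.commute)
qed

section \<open>Counting digit intervals near shifted rationals\<close>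

text \<open>Measured from the nearest integer, all \<open>M\<close> phases stay within
  \<open>pi / 3\<close> of zero, so every term has real part at least 1/2.\<close>

lemma norm_sum_cis_near_int:
  assumes "1 \<le> M" and "infdist y \<int> \<le> 1 / (6 * real M)"
  shows "real M / 2 \<le> norm (\<Sum>k<M. cis (2 * pi * y * real k))"
proof -
  have "\<exists>p\<in>\<int>. infdist y \<int> = dist y p"
    using infdist_attains_inf[of \<int> y] closed_Ints Ints_0 by blast
  then obtain p :: int where p: "infdist y \<int> = \<bar>y - real_of_int p\<bar>"
    by (auto simp: Ints_def dist_real_def)
  have "1 / 2 \<le> cos (2 * pi * y * real k)" if "k < M" for k
  proof -
    define u where "u = 2 * pi * (y - real_of_int p) * real k"
    have "\<bar>y - real_of_int p\<bar> * real k \<le> 1 / (6 * real M) * real M"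
      using p assms that by (intro mult_mono) auto
    then have "\<bar>y - real_of_int p\<bar> * real k \<le> 1 / 6" using assms(1) by simp
    then have "2 * pi * (\<bar>y - real_of_int p\<bar> * real k) \<le> 2 * pi * (1 / 6)"
      by (intro mult_left_mono) auto
    then have "\<bar>u\<bar> \<le> pi / 3" by (simp add: u_def abs_mult)
    then have "cos (pi / 3) \<le> cos \<bar>u\<bar>" by (intro cos_monotone_0_pi_le) (auto simp: field_simps)
    then have "1 / 2 \<le> cos u" by (simp add: cos_60)
    moreover have "2 * pi * y * real k = 2 * pi * ((y - real_of_int p) * real k + real_of_int (p * int k))"
      by (simp add: algebra_simps)
    then have "cis (2 * pi * y * real k) = cis u"
      by (simp only: cis_2pi_add_int u_def) (simp add: mult.assoc)
    then have "cos (2 * pi * y * real k) = cos u" by (metis cis.sel(1))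
    ultimately show ?thesis by simp
  qed
  then have "(\<Sum>k<M. 1 / 2) \<le> (\<Sum>k<M. cos (2 * pi * y * real k))" by (intro sum_mono) auto
  also have "\<dots> = Re (\<Sum>k<M. cis (2 * pi * y * real k))" by simp
  also have "\<dots> \<le> norm (\<Sum>k<M. cis (2 * pi * y * real k))" by (rule complex_Re_le_cmod)
  finally show ?thesis by simp
qed

text \<open>Each positive distance from \<open>k\<close> is attained at most twice, once on either
  side.\<close>

lemma sum_abs_diff_le:
  fixes g :: "nat \<Rightarrow> real"
  assumes g: "\<And>j. 0 \<le> g j" and k: "k < M"
  shows "(\<Sum>l<M. g (nat \<bar>int k - int l\<bar>)) \<le> g 0 + 2 * (\<Sum>j=1..<M. g j)"
proof -
  have "{..<M} = {..<k} \<union> {k} \<union> {k<..<M}" using k by auto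
  then have "(\<Sum>l<M. g (nat \<bar>int k - int l\<bar>))
      = (\<Sum>l<k. g (nat \<bar>int k - int l\<bar>)) + g 0 + (\<Sum>l\<in>{k<..<M}. g (nat \<bar>int k - int l\<bar>))"
    by (simp add: sum.union_disjoint Int_def add_ac)
  also have "(\<Sum>l<k. g (nat \<bar>int k - int l\<bar>)) = (\<Sum>j\<in>{1..k}. g j)"
    by (rule sum.reindex_bij_witness[of _ "\<lambda>j. k - j" "\<lambda>l. k - l"]) (auto simp: nat_diff_distrib of_nat_diff)
  also have "\<dots> \<le> (\<Sum>j=1..<M. g j)" using k g by (intro sum_mono2) auto
  also have "(\<Sum>l\<in>{k<..<M}. g (nat \<bar>int k - int l\<bar>)) = (\<Sum>j\<in>{1..<M - k}. g j)"
    by (rule sum.reindex_bij_witness[of _ "\<lambda>j. k + j" "\<lambda>l. l - k"]) (auto simp: nat_diff_distrib of_nat_diff)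
  also have "\<dots> \<le> (\<Sum>j=1..<M. g j)" using k g by (intro sum_mono2) auto
  finally show ?thesis by simp
qed

text \<open>Tests only left end points of level-\<open>N\<close> intervals. The radius is the one at
  which a sum of \<open>M\<close> exponentials still has modulus at least
  \<open>M / 2\<close>.\<close>

definition cantor15_near :: "nat \<Rightarrow> nat \<Rightarrow> real \<Rightarrow> nat \<Rightarrow> nat set" where
  "cantor15_near N M \<gamma> q =
     {a \<in> cantor15_ints N. infdist (real q * (real a / 15 ^ N) - \<gamma>) \<int> \<le> 1 / (6 * real M)}"

lemma norm_cantor15_esum_0 [simp]: "norm (cantor15_esum N 0) = 14 ^ N"
  by (simp add: cantor15_esum_def norm_power)

text \<open>The Fejer kernel majorises the indicator of a neighbourhood of the integers.\<close>

lemma card_cantor15_near_le: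
  assumes "1 \<le> M"
  shows "real (card (cantor15_near N M \<gamma> q))
    \<le> 4 / real M * (14 ^ N + 2 * (\<Sum>j=1..<M. norm (cantor15_esum N (real (j * q)))))"
proof -
  let ?A = "cantor15_ints N"
  define y where "y a = real q * (real a / 15 ^ N) - \<gamma>" for a
  define F where "F a = (norm (\<Sum>k<M. cis (2 * pi * y a * real k)))\<^sup>2" for a
  define g where "g j = norm (cantor15_esum N (real (j * q)))" for j :: nat
  have "real (card (cantor15_near N M \<gamma> q)) * (real M / 2)\<^sup>2 = (\<Sum>a\<in>cantor15_near N M \<gamma> q. (real M / 2)\<^sup>2)"
    by simp
  also have "\<dots> \<le> (\<Sum>a\<in>cantor15_near N M \<gamma> q. F a)"
    unfolding F_def
    by (intro sum_mono power_mono norm_sum_cis_near_int assms) (auto simp: cantor15_near_def y_def)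
  also have "\<dots> \<le> (\<Sum>a\<in>?A. F a)"
    by (intro sum_mono2) (auto simp: cantor15_near_def F_def)
  also have "\<dots> \<le> norm (complex_of_real (\<Sum>a\<in>?A. F a))"
    unfolding norm_of_real by (rule abs_ge_self)
  also have "complex_of_real (\<Sum>a\<in>?A. F a) =
      (\<Sum>a\<in>?A. \<Sum>k<M. \<Sum>l<M. cis (- (2 * pi * \<gamma> * (real k - real l))) *
        cis (2 * pi * ((real k - real l) * real q) * real a / 15 ^ N))"
  proof -
    have "complex_of_real (F a) = (\<Sum>k<M. \<Sum>l<M. cis (- (2 * pi * \<gamma> * (real k - real l))) *
        cis (2 * pi * ((real k - real l) * real q) * real a / 15 ^ N))" for a
    proof -
      have "complex_of_real (F a)
          = (\<Sum>k<M. cis (2 * pi * y a * real k)) * cnj (\<Sum>k<M. cis (2 * pi * y a * real k))"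
        unfolding F_def by (rule complex_norm_square)
      also have "\<dots> = (\<Sum>k<M. \<Sum>l<M. cis (2 * pi * y a * real k) * cis (- (2 * pi * y a * real l)))"
        by (simp add: sum_product cis_cnj)
      finally show ?thesis
        by (simp add: cis_mult y_def algebra_simps diff_divide_distrib add_divide_distrib)
    qed
    then show ?thesis by (simp add: of_real_sum)
  qed
  also have "\<dots> = (\<Sum>k<M. \<Sum>l<M. cis (- (2 * pi * \<gamma> * (real k - real l))) *
      cantor15_esum N ((real k - real l) * real q))"
    unfolding cantor15_esum_def sum_distrib_left
    by (simp only: sum.swap[of _ _ ?A])
  \<comment> \<open>The shift \<open>\<gamma>\<close> enters only through a unimodular factor, which
    makes the bound uniform in \<open>\<gamma>\<close>.\<close>
  also have "norm \<dots> \<le> (\<Sum>k<M. \<Sum>l<M. norm (cantor15_esum N ((real k - real l) * real q)))"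
    by (intro sum_norm_le) (simp add: norm_mult)
  also have "\<dots> = (\<Sum>k<M. \<Sum>l<M. g (nat \<bar>int k - int l\<bar>))"
  proof (intro sum.cong refl)
    fix k l
    show "norm (cantor15_esum N ((real k - real l) * real q)) = g (nat \<bar>int k - int l\<bar>)"
    proof (cases "l \<le> k")
      case True
      then show ?thesis by (simp add: g_def of_nat_diff)
    next
      case False
      then have "(real k - real l) * real q = - (real (nat \<bar>int k - int l\<bar> * q))"
        by (simp add: algebra_simps)
      then show ?thesis by (simp only: norm_cantor15_esum_minus g_def)
    qed
  qed
  also have "\<dots> \<le> (\<Sum>k<M. g 0 + 2 * (\<Sum>j=1..<M. g j))"
    by (intro sum_mono sum_abs_diff_le) (auto simp: g_def)
  \<comment> \<open>The term \<open>g 0\<close> is the zero frequency, of size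
    \<open>14 ^ N\<close>.\<close>
  also have "\<dots> = real M * (14 ^ N + 2 * (\<Sum>j=1..<M. g j))" by (simp add: g_def)
  finally have "real (card (cantor15_near N M \<gamma> q)) * (real M / 2)\<^sup>2
      \<le> real M * (14 ^ N + 2 * (\<Sum>j=1..<M. g j))" .
  then have "real M * (real (card (cantor15_near N M \<gamma> q)) * real M)
      \<le> real M * (4 * (14 ^ N + 2 * (\<Sum>j=1..<M. g j)))"
    by (simp add: power2_eq_square algebra_simps)
  then have "real (card (cantor15_near N M \<gamma> q)) * real M \<le> 4 * (14 ^ N + 2 * (\<Sum>j=1..<M. g j))"
    using assms by (subst (asm) mult_le_cancel_left_pos) auto
  then show ?thesis using assms unfolding g_def by (simp add: pos_le_divide_eq)
qed

text \<open>Pairs are grouped by their product \<open>n = j * q\<close>, which arises at most as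
  often as \<open>n\<close> has divisors. Since \<open>Q * M \<le> 15 ^ N\<close>, all products fall
  into one period, where the sum of the moduli is under control.\<close>

lemma sum_norm_cantor15_esum_products_le:
  assumes \<open>0 \<le> \<epsilon>\<close> and d: "\<forall>n\<ge>1. real (card {d. d dvd n}) \<le> C * real n powr \<epsilon>"
    and QM: "Q * M \<le> 15 ^ N" and "1 \<le> M" and C: "0 < C"
  shows "(\<Sum>q=1..Q. \<Sum>j=1..<M. norm (cantor15_esum N (real (j * q))))
    \<le> C * (15 ^ N) powr \<epsilon> * (107 / 2) ^ N"
proof -
  let ?P = "{1..Q} \<times> {1..<M}"
  let ?h = "\<lambda>(q, j). j * q :: nat"
  let ?f = "\<lambda>n. norm (cantor15_esum N (real n))"
  have img: "?h ` ?P \<subseteq> {1..<15 ^ N}"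
  proof clarsimp
    fix q j assume "Suc 0 \<le> q" "q \<le> Q" "Suc 0 \<le> j" "j < M"
    then have "j * q < M * Q" by (meson le_less_trans mult_le_mono2 mult_less_mono1 less_le_trans zero_less_Suc)
    with QM show "j * q < 15 ^ N" by (simp add: mult.commute)
  qed
  have "(\<Sum>q=1..Q. \<Sum>j=1..<M. ?f (j * q)) = (\<Sum>p\<in>?P. ?f (?h p))"
    by (simp add: sum.cartesian_product case_prod_unfold)
  also have "\<dots> = (\<Sum>n\<in>?h ` ?P. \<Sum>p\<in>{p\<in>?P. ?h p = n}. ?f (?h p))"
    by (intro sum.image_gen) auto
  also have "\<dots> = (\<Sum>n\<in>?h ` ?P. real (card {p\<in>?P. ?h p = n}) * ?f n)"
    by (intro sum.cong refl) simp
  also have "\<dots> \<le> (\<Sum>n\<in>?h ` ?P. C * (15 ^ N) powr \<epsilon> * ?f n)"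
  proof (intro sum_mono mult_right_mono)
    fix n assume "n \<in> ?h ` ?P"
    then have n: "1 \<le> n" "n < 15 ^ N" using img by auto
    \<comment> \<open>As \<open>q \<ge> 1\<close>, the product and \<open>q\<close> together
      determine \<open>j\<close>.\<close>
    have "inj_on fst {p\<in>?P. ?h p = n}"
      by (rule inj_onI) auto
    moreover have "fst ` {p\<in>?P. ?h p = n} \<subseteq> {d. d dvd n}" by auto
    ultimately have "card {p\<in>?P. ?h p = n} \<le> card {d. d dvd n}"
      using n by (intro card_inj_on_le) auto
    also have "real \<dots> \<le> C * real n powr \<epsilon>" using d n by blast
    also have "real n powr \<epsilon> \<le> (15 ^ N) powr \<epsilon>"
    proof (intro powr_mono2)
      have "real n \<le> real (15 ^ N)" using n by (simp only: of_nat_le_iff)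
      then show "real n \<le> 15 ^ N" by simp
    qed (use \<open>0 \<le> \<epsilon>\<close> in auto)
    finally show "real (card {p\<in>?P. ?h p = n}) \<le> C * (15 ^ N) powr \<epsilon>" using C by simp
  qed auto
  also have "\<dots> \<le> (\<Sum>n<15 ^ N. C * (15 ^ N) powr \<epsilon> * ?f n)"
    using img C by (intro sum_mono2) auto
  also have "\<dots> \<le> C * (15 ^ N) powr \<epsilon> * (107 / 2) ^ N"
    unfolding sum_distrib_left[symmetric] using C
    by (intro mult_left_mono sum_norm_cantor15_esum_le) auto
  finally show ?thesis .
qed

text \<open>Closed on the right as well, because an expansion whose digits are eventually all 14 can
  land on the right end point.\<close>

definition cantor15_interval :: "nat \<Rightarrow> nat \<Rightarrow> real set" where
  "cantor15_interval N a = {real a / 15 ^ N .. (real a + 1) / 15 ^ N}"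

definition cantor15_hits :: "nat \<Rightarrow> real \<Rightarrow> real \<Rightarrow> nat \<Rightarrow> nat set" where
  "cantor15_hits N \<delta> \<gamma> Q =
     {a \<in> cantor15_ints N. \<exists>x\<in>cantor15_interval N a. \<exists>q\<in>{1..Q}.
        infdist (real q * x - \<gamma>) \<int> \<le> \<delta>}"

text \<open>Moving from a point of the interval to its left end point changes \<open>q * x\<close>
  by at most \<open>Q / 15 ^ N\<close>, hence by at most \<open>1 / (12 M)\<close>; together with
  \<open>\<delta>\<close> this fills the radius \<open>1 / (6 M)\<close>.\<close>

lemma cantor15_hits_subset:
  assumes "1 \<le> M" and \<delta>: "\<delta> \<le> 1 / (12 * real M)" and N: "12 * Q * M \<le> 15 ^ N"
  shows "cantor15_hits N \<delta> \<gamma> Q \<subseteq> (\<Union>q\<in>{1..Q}. cantor15_near N M \<gamma> q)"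
proof
  fix a assume "a \<in> cantor15_hits N \<delta> \<gamma> Q"
  then obtain x q where a: "a \<in> cantor15_ints N" and x: "x \<in> cantor15_interval N a"
    and q: "q \<in> {1..Q}" and d: "infdist (real q * x - \<gamma>) \<int> \<le> 1 / (12 * real M)"
    using \<delta> by (force simp: cantor15_hits_def)
  have "\<bar>real a / 15 ^ N - x\<bar> \<le> 1 / 15 ^ N"
    using x by (auto simp: cantor15_interval_def abs_le_iff add_divide_distrib)
  then have "real q * \<bar>real a / 15 ^ N - x\<bar> \<le> real Q * (1 / 15 ^ N)"
    using q by (intro mult_mono) auto
  also have "\<dots> \<le> 1 / (12 * real M)"
  proof -
    have "real (12 * Q * M) \<le> real (15 ^ N)" using N by (simp only: of_nat_le_iff)
    then show ?thesis using assms(1) by (simp add: field_simps)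
  qed
  finally have *: "dist (real q * (real a / 15 ^ N) - \<gamma>) (real q * x - \<gamma>) \<le> 1 / (12 * real M)"
    by (simp add: dist_real_def abs_mult right_diff_distrib [symmetric] del: times_divide_eq_right)
  have "infdist (real q * (real a / 15 ^ N) - \<gamma>) \<int>
      \<le> infdist (real q * x - \<gamma>) \<int> + dist (real q * (real a / 15 ^ N) - \<gamma>) (real q * x - \<gamma>)"
    by (rule infdist_triangle)
  also have "\<dots> \<le> 1 / (12 * real M) + 1 / (12 * real M)" using d * by linarith
  also have "\<dots> = 1 / (6 * real M)" by simp
  finally show "a \<in> (\<Union>q\<in>{1..Q}. cantor15_near N M \<gamma> q)"
    using a q by (auto simp: cantor15_near_def)
qed

lemma cantor15_hits_bound:
  obtains \<nu>\<^sub>0 C :: real where "1 < \<nu>\<^sub>0" "0 < C"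
    "\<And>N M \<delta> \<gamma> Q. \<lbrakk>1 \<le> M; 1 \<le> Q; \<delta> \<le> 1 / (12 * real M); 12 * Q * M \<le> 15 ^ N; 15 ^ N \<le> 180 * Q * M; real M \<le> real Q powr \<nu>\<^sub>0\<rbrakk>
      \<Longrightarrow> real (card (cantor15_hits N \<delta> \<gamma> Q)) \<le> C * 14 ^ N * real Q / real M"
proof -
  \<comment> \<open>The quotient \<open>107 / 28\<close> is the one-digit bound
    \<open>107 / 2\<close> divided by 14, so \<open>t\<close> measures the loss per frequency range
    relative to the zero frequency.\<close>
  define t where "t = log 15 (107 / 28 :: real)"
  have t0: "0 < t" by (simp add: t_def)
  have "2 * t = log 15 ((107 / 28)\<^sup>2)" by (simp add: t_def log_nat_power)
  \<comment> \<open>The decisive inequality \<open>107 / 2 < 14 * sqrt 15\<close>, in the form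
    \<open>t < 1 / 2\<close>.\<close>
  also have "\<dots> < 1" by (simp add: power2_eq_square)
  finally have t1: "t < 1 / 2" by simp
  \<comment> \<open>Half of the remaining room goes to the divisor bound, so that
    \<open>\<tau> = t + \<epsilon>\<close> is still below 1/2.\<close>
  define \<epsilon> where "\<epsilon> = (1 / 2 - t) / 2"
  have e: "0 < \<epsilon>" using t1 by (simp add: \<epsilon>_def)
  define \<tau> where "\<tau> = t + \<epsilon>"
  have \<tau>: "0 < \<tau>" "\<tau> < 1 / 2" using t0 t1 e by (auto simp: \<tau>_def \<epsilon>_def field_simps)
  \<comment> \<open>Chosen so that \<open>(Q * Q powr \<nu>\<^sub>0) powr \<tau> = Q\<close>: up to
    this exponent the nonzero frequencies cost no more than the zero frequency, up to a constant. It
    exceeds 1 because \<open>\<tau> < 1 / 2\<close>.\<close>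
  define \<nu>\<^sub>0 where "\<nu>\<^sub>0 = 1 / \<tau> - 1"
  have \<nu>: "1 < \<nu>\<^sub>0" "(1 + \<nu>\<^sub>0) * \<tau> = 1" using \<tau> by (auto simp: \<nu>\<^sub>0_def field_simps)
  obtain C where C: "0 < C" "\<forall>n\<ge>1. real (card {d. d dvd n}) \<le> C * real n powr \<epsilon>"
    using divisor_bound[OF e] by blast
  define C' where "C' = 4 * (1 + 2 * C * 180 powr \<tau>)"
  have bound: "real (card (cantor15_hits N \<delta> \<gamma> Q)) \<le> C' * 14 ^ N * real Q / real M"
    if M: "1 \<le> M" and Q: "1 \<le> Q" and \<delta>: "\<delta> \<le> 1 / (12 * real M)" and lo: "12 * Q * M \<le> 15 ^ N" and hi: "15 ^ N \<le> 180 * Q * M"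
      and MQ: "real M \<le> real Q powr \<nu>\<^sub>0" for N M Q :: nat and \<delta> \<gamma> :: real
  proof -
    have "(107 / 2) ^ N = 14 ^ N * (107 / 28 :: real) ^ N" by (simp flip: power_mult_distrib)
    also have "(107 / 28 :: real) = 15 powr t" by (simp add: t_def)
    also have "(15 powr t) ^ N = (15 ^ N) powr t" by (simp add: powr_powr mult_ac flip: powr_realpow)
    finally have L: "(107 / 2) ^ N = 14 ^ N * (15 ^ N :: real) powr t" .
    have "(15 ^ N :: real) powr \<tau> \<le> (180 * (real Q * real M)) powr \<tau>"
    proof (intro powr_mono2)
      have "real (15 ^ N) \<le> real (180 * Q * M)" using hi by (simp only: of_nat_le_iff)
      then show "15 ^ N \<le> 180 * (real Q * real M)" by simp
    qed (use \<tau> in auto)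
    also have "\<dots> = 180 powr \<tau> * (real Q * real M) powr \<tau>" by (simp add: powr_mult)
    also have "(real Q * real M) powr \<tau> \<le> (real Q * real Q powr \<nu>\<^sub>0) powr \<tau>"
      using MQ \<tau> by (intro powr_mono2 mult_left_mono) auto
    also have "real Q * real Q powr \<nu>\<^sub>0 = real Q powr (1 + \<nu>\<^sub>0)" using Q by (simp add: powr_add)
    also have "(real Q powr (1 + \<nu>\<^sub>0)) powr \<tau> = real Q" using \<nu> Q by (simp add: powr_powr)
    finally have T: "(15 ^ N :: real) powr \<tau> \<le> 180 powr \<tau> * real Q" by simp
    have "Q * M \<le> 15 ^ N" using lo by linarith
    then have "(\<Sum>q=1..Q. \<Sum>j=1..<M. norm (cantor15_esum N (real (j * q))))
        \<le> C * (15 ^ N) powr \<epsilon> * (107 / 2) ^ N"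
      using e C M by (intro sum_norm_cantor15_esum_products_le) auto
    also have "\<dots> = C * 14 ^ N * (15 ^ N) powr \<tau>" unfolding L by (simp add: \<tau>_def powr_add mult_ac)
    also have "\<dots> \<le> C * 14 ^ N * (180 powr \<tau> * real Q)" using T C by (intro mult_left_mono) auto
    finally have S: "(\<Sum>q=1..Q. \<Sum>j=1..<M. norm (cantor15_esum N (real (j * q))))
        \<le> C * 14 ^ N * (180 powr \<tau> * real Q)" .
    have "card (cantor15_hits N \<delta> \<gamma> Q) \<le> card (\<Union>q\<in>{1..Q}. cantor15_near N M \<gamma> q)"
      using cantor15_hits_subset[OF M \<delta> lo] by (intro card_mono) (auto simp: cantor15_near_def)
    also have "\<dots> \<le> (\<Sum>q=1..Q. card (cantor15_near N M \<gamma> q))" by (rule card_UN_le) simp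
    finally have "real (card (cantor15_hits N \<delta> \<gamma> Q)) \<le> (\<Sum>q=1..Q. real (card (cantor15_near N M \<gamma> q)))"
      by (metis of_nat_mono of_nat_sum)
    also have "\<dots> \<le> (\<Sum>q=1..Q. 4 / real M * (14 ^ N + 2 * (\<Sum>j=1..<M. norm (cantor15_esum N (real (j * q))))))"
      by (intro sum_mono card_cantor15_near_le M)
    also have "\<dots> = 4 / real M * (real Q * 14 ^ N + 2 * (\<Sum>q=1..Q. \<Sum>j=1..<M. norm (cantor15_esum N (real (j * q)))))"
      by (simp only: sum_distrib_left[symmetric] sum.distrib) simp
    also have "\<dots> \<le> 4 / real M * (real Q * 14 ^ N + 2 * (C * 14 ^ N * (180 powr \<tau> * real Q)))"
      using S by (intro mult_left_mono add_left_mono) auto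
    also have "\<dots> = C' * 14 ^ N * real Q / real M" by (simp add: C'_def divide_inverse algebra_simps)
    finally show ?thesis .
  qed
  have "0 < C'" unfolding C'_def using C by (simp add: add_pos_nonneg)
  from that[OF \<nu>(1) this bound] show thesis by blast
qed

section \<open>The Cantor measure\<close>

definition cantor15_stream :: "(nat \<Rightarrow> nat) measure" where
  "cantor15_stream = (\<Pi>\<^sub>M _\<in>UNIV. measure_pmf (pmf_of_set cantor15_digits))"

definition cantor15_expansion :: "(nat \<Rightarrow> nat) \<Rightarrow> real" where
  "cantor15_expansion a = (\<Sum>j. real (a j) / 15 ^ Suc j)"

primrec cantor15_prefix :: "nat \<Rightarrow> (nat \<Rightarrow> nat) \<Rightarrow> nat" where
  "cantor15_prefix 0 a = 0"
| "cantor15_prefix (Suc N) a = 15 * cantor15_prefix N a + a N"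

lemma cantor15_measure_eq: "cantor15_measure = distr cantor15_stream borel cantor15_expansion"
  unfolding cantor15_measure_def cantor15_stream_def cantor15_expansion_def cantor15_digits_def ..

lemma prob_space_cantor15_stream: "prob_space cantor15_stream"
  unfolding cantor15_stream_def by (intro prob_space_PiM prob_space_measure_pmf)

lemma space_cantor15_stream [simp]: "space cantor15_stream = UNIV"
  by (simp add: cantor15_stream_def space_PiM)

lemma borel_measurable_cantor15_expansion [measurable]:
  "cantor15_expansion \<in> borel_measurable cantor15_stream"
proof -
  have "(\<lambda>a. real (a j)) \<in> borel_measurable cantor15_stream" for j
    unfolding cantor15_stream_def
    by (rule measurable_compose[OF measurable_component_singleton[of j]]) auto
  then show ?thesis unfolding cantor15_expansion_def by measurable
qed

lemma sets_cantor15_measure [simp, measurable_cong]: "sets cantor15_measure = sets borel"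
  and space_cantor15_measure [simp]: "space cantor15_measure = UNIV"
  by (simp_all add: cantor15_measure_eq)

lemma prob_space_cantor15_measure: "prob_space cantor15_measure"
  unfolding cantor15_measure_eq
  by (intro prob_space.prob_space_distr prob_space_cantor15_stream borel_measurable_cantor15_expansion)

lemma AE_cantor15_stream: "AE a in cantor15_stream. \<forall>j. a j \<in> cantor15_digits"
proof -
  have "cantor15_digits \<noteq> {}" using card_cantor15_digits by fastforce
  then have "AE d in measure_pmf (pmf_of_set cantor15_digits). d \<in> cantor15_digits"
    by (simp add: AE_measure_pmf_iff)
  then have "AE a in cantor15_stream. a j \<in> cantor15_digits" for j
    unfolding cantor15_stream_def by (intro AE_PiM_component) (auto intro: prob_space_measure_pmf)
  then show ?thesis by (simp add: AE_all_countable)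
qed

lemma cantor15_prefix_in: "(\<forall>j. a j \<in> cantor15_digits) \<Longrightarrow> cantor15_prefix N a \<in> cantor15_ints N"
  by (induction N) (auto intro!: image_eqI[where x = "(_, _)"])

text \<open>The prefix determines its digits, index 0 being the most significant; hence all
  admissible sequences with a given prefix lie in one cylinder.\<close>

lemma cantor15_prefix_digit:
  assumes "\<forall>j. a j \<in> cantor15_digits" and "j < N"
  shows "cantor15_prefix N a div 15 ^ (N - 1 - j) mod 15 = a j"
  using assms(2)
proof (induction N)
  case (Suc N)
  have lt: "a N < 15" using assms(1) cantor15_digits_less by blast
  show ?case
  proof (cases "j = N")
    case True
    with lt show ?thesis by simp
  next
    case False
    with Suc.prems have "j < N" by simp
    then have "Suc N - 1 - j = Suc (N - 1 - j)" by simp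
    then have "cantor15_prefix (Suc N) a div 15 ^ (Suc N - 1 - j)
        = (15 * cantor15_prefix N a + a N) div 15 div 15 ^ (N - 1 - j)"
      by (simp only: power_Suc div_mult2_eq cantor15_prefix.simps)
    also have "(15 * cantor15_prefix N a + a N) div 15 = cantor15_prefix N a" using lt by simp
    finally show ?thesis using Suc.IH[OF \<open>j < N\<close>] by simp
  qed
qed simp

text \<open>The first \<open>N\<close> terms sum to the left end point, and the tail is at most that
  of constant digit 14, which is exactly \<open>1 / 15 ^ N\<close>.\<close>

lemma cantor15_expansion_in:
  assumes "\<forall>j. a j \<in> cantor15_digits"
  shows "cantor15_expansion a \<in> cantor15_interval N (cantor15_prefix N a)"
proof -
  have geo: "(\<lambda>j. 14 * (1 / 15) ^ Suc N * (1 / 15 :: real) ^ j) sums (14 * (1 / 15) ^ Suc N * (1 / (1 - 1 / 15)))"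
    for N :: nat by (intro sums_mult geometric_sums) simp
  have le: "real (a (j + N)) / 15 ^ Suc (j + N) \<le> 14 * (1 / 15) ^ Suc N * (1 / 15) ^ j" for j N
  proof -
    have "a (j + N) \<le> 14" using cantor15_digits_less assms by (metis less_Suc_eq_le eval_nat_numeral(3))
    then show ?thesis by (simp add: power_add field_simps)
  qed
  have sm: "summable (\<lambda>j. real (a (j + N)) / 15 ^ Suc (j + N))" for N
    by (rule summable_comparison_test'[OF sums_summable[OF geo[of N]]]) (use le in auto)
  have "(\<Sum>j. real (a (j + N)) / 15 ^ Suc (j + N)) \<le> (\<Sum>j. 14 * (1 / 15) ^ Suc N * (1 / 15) ^ j)"
    by (intro suminf_le sm sums_summable[OF geo] le)
  also have "\<dots> = 1 / 15 ^ N" unfolding sums_unique[OF geo, symmetric] by (simp add: power_one_over)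
  finally have up: "(\<Sum>j. real (a (j + N)) / 15 ^ Suc (j + N)) \<le> 1 / 15 ^ N" .
  have lo: "0 \<le> (\<Sum>j. real (a (j + N)) / 15 ^ Suc (j + N))" by (intro suminf_nonneg sm) auto
  have pre: "(\<Sum>j<N. real (a j) / 15 ^ Suc j) = real (cantor15_prefix N a) / 15 ^ N"
    by (induction N) (auto simp: field_simps)
  have "cantor15_expansion a
      = (\<Sum>j. real (a (j + N)) / 15 ^ Suc (j + N)) + (\<Sum>j<N. real (a j) / 15 ^ Suc j)"
    unfolding cantor15_expansion_def using suminf_split_initial_segment[OF sm[of 0], of N] by simp
  with pre up lo show ?thesis by (simp add: cantor15_interval_def add_divide_distrib)
qed

text \<open>The prescribed digits are arbitrary; a forbidden one has probability 0, an allowed one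
  1/14.\<close>

lemma emeasure_cantor15_cylinder_le:
  "emeasure cantor15_stream {a. \<forall>j<N. a j = d j} \<le> ennreal (1 / 14 ^ N)"
  "{a. \<forall>j<N. a j = d j} \<in> sets cantor15_stream"
proof -
  let ?M = "\<lambda>_. measure_pmf (pmf_of_set cantor15_digits)"
  interpret product_prob_space ?M "UNIV :: nat set"
    by unfold_locales
  have eq: "{a. \<forall>j<N. a j = d j} = prod_emb UNIV ?M {..<N} (\<Pi>\<^sub>E j\<in>{..<N}. {d j})"
  proof (intro equalityI subsetI)
    fix a assume "a \<in> prod_emb UNIV ?M {..<N} (\<Pi>\<^sub>E j\<in>{..<N}. {d j})"
    then have "restrict a {..<N} j = d j" if "j < N" for j
      using that by (auto simp: prod_emb_def dest: PiE_mem)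
    then show "a \<in> {a. \<forall>j<N. a j = d j}" by simp
  qed (simp add: prod_emb_def space_PiM)
  have "cantor15_digits \<noteq> {}" using card_cantor15_digits by fastforce
  then have "pmf (pmf_of_set cantor15_digits) x \<le> 1 / 14" for x
    by (auto simp: pmf_of_set indicator_def)
  then have "(\<Prod>j<N. pmf (pmf_of_set cantor15_digits) (d j)) \<le> (\<Prod>j<N. 1 / 14)"
    by (intro prod_mono) auto
  then have "ennreal (\<Prod>j<N. pmf (pmf_of_set cantor15_digits) (d j)) \<le> ennreal (1 / 14 ^ N)"
    by (intro ennreal_leI) (simp add: power_one_over)
  then show "emeasure cantor15_stream {a. \<forall>j<N. a j = d j} \<le> ennreal (1 / 14 ^ N)"
    unfolding eq cantor15_stream_def
    by (subst emeasure_PiM_emb) (auto simp: emeasure_pmf_single prod_ennreal)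
  show "{a. \<forall>j<N. a j = d j} \<in> sets cantor15_stream"
    unfolding eq cantor15_stream_def by (intro sets_PiM_I) auto
qed

text \<open>Turns interval counts into measure bounds: almost every sequence with expansion in
  \<open>E\<close> has a prefix whose interval meets \<open>E\<close>, and each prefix costs one
  cylinder of mass at most \<open>1 / 14 ^ N\<close>.\<close>

lemma emeasure_cantor15_le:
  assumes E: "E \<in> sets borel"
  shows "emeasure cantor15_measure E
    \<le> ennreal (real (card {a \<in> cantor15_ints N. cantor15_interval N a \<inter> E \<noteq> {}}) / 14 ^ N)"
proof -
  define H where "H = {a \<in> cantor15_ints N. cantor15_interval N a \<inter> E \<noteq> {}}"
  define B where "B a = {\<omega>. \<forall>j<N. \<omega> j = a div 15 ^ (N - 1 - j) mod 15}" for a :: nat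
  have [simp]: "finite H" by (simp add: H_def)
  have B: "B a \<in> sets cantor15_stream" "emeasure cantor15_stream (B a) \<le> ennreal (1 / 14 ^ N)" for a
    unfolding B_def by (rule emeasure_cantor15_cylinder_le)+
  have "emeasure cantor15_measure E = emeasure cantor15_stream (cantor15_expansion -` E)"
    unfolding cantor15_measure_eq using E by (subst emeasure_distr) auto
  also have "\<dots> \<le> emeasure cantor15_stream (\<Union>a\<in>H. B a)"
  proof (rule emeasure_mono_AE)
    show "AE \<omega> in cantor15_stream. \<omega> \<in> cantor15_expansion -` E \<longrightarrow> \<omega> \<in> (\<Union>a\<in>H. B a)"
      using AE_cantor15_stream
    proof eventually_elim
      case (elim \<omega>)
      have "\<omega> \<in> B (cantor15_prefix N \<omega>)" using cantor15_prefix_digit[OF elim] by (simp add: B_def)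
      moreover have "cantor15_prefix N \<omega> \<in> H" if "cantor15_expansion \<omega> \<in> E"
        using that cantor15_expansion_in[OF elim] cantor15_prefix_in[OF elim] by (auto simp: H_def)
      ultimately show ?case by auto
    qed
  qed (use B in auto)
  also have "\<dots> \<le> (\<Sum>a\<in>H. emeasure cantor15_stream (B a))"
    using B by (intro emeasure_subadditive_finite) auto
  also have "\<dots> \<le> (\<Sum>a\<in>H. ennreal (1 / 14 ^ N))" by (intro sum_mono B)
  also have "\<dots> = ennreal (\<Sum>a\<in>H. 1 / 14 ^ N)" by (intro sum_ennreal) auto
  finally show ?thesis by (simp add: H_def)
qed

section \<open>The support of the Cantor measure and the mass of short intervals\<close>

lemma closed_cantor15_cover: "closed (\<Union>a\<in>cantor15_ints N. cantor15_interval N a)"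
  by (intro closed_UN) (auto simp: cantor15_interval_def)

text \<open>The complement of the cover is open and meets none of the intervals, so it is null and
  contains no point of the support.\<close>

lemma cantor15_set_subset: "cantor15_set \<subseteq> (\<Union>a\<in>cantor15_ints N. cantor15_interval N a)"
proof
  let ?U = "\<Union>a\<in>cantor15_ints N. cantor15_interval N a"
  fix x assume x: "x \<in> cantor15_set"
  show "x \<in> ?U"
  proof (rule ccontr)
    assume "x \<notin> ?U"
    moreover have "open (- ?U)" using closed_cantor15_cover by (rule open_Compl)
    ultimately have "0 < emeasure cantor15_measure (- ?U)"
      using x by (simp add: cantor15_set_def measure_support_def)
    moreover have "{a \<in> cantor15_ints N. cantor15_interval N a \<inter> (- ?U) \<noteq> {}} = {}" by auto
    then have "emeasure cantor15_measure (- ?U) \<le> 0"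
      using emeasure_cantor15_le[of "- ?U" N] \<open>open (- ?U)\<close> by (metis borel_open card.empty divide_eq_0_iff ennreal_0 of_nat_0)
    ultimately show False by simp
  qed
qed

text \<open>A point outside the support has a null basic neighbourhood, and a countable basis
  supplies only countably many of these.\<close>

lemma null_sets_Compl_measure_support:
  fixes M :: "'a::second_countable_topology measure"
  assumes [simp]: "sets M = sets borel"
  shows "- measure_support M \<in> null_sets M"
proof -
  obtain B :: "'a set set" where B: "countable B" "topological_basis B"
    using ex_countable_basis by blast
  have "- measure_support M = (\<Union>b\<in>{b\<in>B. emeasure M b = 0}. b)"
  proof (intro equalityI subsetI)
    fix x assume "x \<in> - measure_support M"
    then obtain U where U: "open U" "x \<in> U" "emeasure M U = 0"
      by (auto simp: measure_support_def)
    then obtain b where b: "b \<in> B" "x \<in> b" "b \<subseteq> U" using B(2) topological_basisE by blast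
    then have "emeasure M b \<le> emeasure M U" using U by (intro emeasure_mono) auto
    with b U show "x \<in> (\<Union>b\<in>{b\<in>B. emeasure M b = 0}. b)" by auto
  next
    fix x assume "x \<in> (\<Union>b\<in>{b\<in>B. emeasure M b = 0}. b)"
    then show "x \<in> - measure_support M"
      using topological_basis_open[OF B(2)] by (auto simp: measure_support_def)
  qed
  moreover have "(\<Union>b\<in>{b\<in>B. emeasure M b = 0}. b) \<in> null_sets M"
    using B topological_basis_open[OF B(2)] by (intro null_sets_UN') (auto simp: null_sets_def)
  ultimately show ?thesis by simp
qed

lemma emeasure_cantor15_set: "cantor15_set \<in> sets borel" "emeasure cantor15_measure cantor15_set = 1"
proof -
  interpret prob_space cantor15_measure by (rule prob_space_cantor15_measure)
  have null: "- cantor15_set \<in> null_sets cantor15_measure"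
    unfolding cantor15_set_def by (rule null_sets_Compl_measure_support) simp
  then have "- cantor15_set \<in> sets borel" by (simp add: null_sets_def)
  then have "- (- cantor15_set) \<in> sets borel" by (rule borel_comp)
  then show K: "cantor15_set \<in> sets borel" by (simp only: double_complement)
  have "AE x in cantor15_measure. x \<in> cantor15_set" using AE_not_in[OF null] by simp
  with K show "emeasure cantor15_measure cantor15_set = 1" by (intro emeasure_eq_1_AE) auto
qed

text \<open>With \<open>z = 15 ^ N * u - 1\<close>, the interval of \<open>a\<close> can meet
  \<open>{u..v}\<close> only if \<open>z \<le> a \<le> z + 3\<close>, which leaves at most four
  integers.\<close>

lemma emeasure_cantor15_small_interval_le:
  assumes "v - u \<le> 2 / 15 ^ N"
  shows "emeasure cantor15_measure {u..v} \<le> ennreal (4 / 14 ^ N)"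
proof -
  define z where "z = 15 ^ N * u - 1"
  let ?H = "{a \<in> cantor15_ints N. cantor15_interval N a \<inter> {u..v} \<noteq> {}}"
  have "int ` ?H \<subseteq> {\<lceil>z\<rceil>..\<lceil>z\<rceil> + 3}"
  proof (rule image_subsetI)
    fix a assume "a \<in> ?H"
    then obtain x where x: "x \<in> cantor15_interval N a" "u \<le> x" "x \<le> v" by auto
    then have "real a / 15 ^ N \<le> v" "u \<le> (real a + 1) / 15 ^ N" by (auto simp: cantor15_interval_def)
    then have "real a / 15 ^ N \<le> u + 2 / 15 ^ N" "u \<le> (real a + 1) / 15 ^ N" using assms by auto
    then have "real a \<le> z + 3" "z \<le> real a" by (simp_all add: z_def field_simps)
    then have "\<lceil>z\<rceil> \<le> int a \<and> int a \<le> \<lceil>z\<rceil> + 3" by linarith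
    then show "int a \<in> {\<lceil>z\<rceil>..\<lceil>z\<rceil> + 3}" by simp
  qed
  then have "card (int ` ?H) \<le> card {\<lceil>z\<rceil>..\<lceil>z\<rceil> + 3}" by (intro card_mono) auto
  then have "card ?H \<le> 4" by (simp add: card_image)
  then have "ennreal (real (card ?H) / 14 ^ N) \<le> ennreal (4 / 14 ^ N)"
    by (intro ennreal_leI divide_right_mono) auto
  with emeasure_cantor15_le[of "{u..v}" N] show ?thesis by (meson atLeastAtMost_borel order_trans)
qed

section \<open>Hausdorff measure and dyadic blocks\<close>

text \<open>A Borel-Cantelli lemma for Hausdorff measure: the sets of index at least
  \<open>k0\<close> cover \<open>A\<close>, are arbitrarily small, and have total gauge at most a
  tail of a convergent series.\<close>

lemma hausdorff_measure_limsup_zero: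
  fixes F :: "nat \<Rightarrow> nat \<Rightarrow> 'a::metric_space set"
  assumes H: "\<And>k. finite (H k)" and c: "summable c" "\<And>k. 0 \<le> c k" and r: "r \<longlonglongrightarrow> 0"
    and F: "\<And>k a. \<lbrakk>K \<le> k; a \<in> H k\<rbrakk> \<Longrightarrow> bounded (F k a)"
      "\<And>k a. \<lbrakk>K \<le> k; a \<in> H k\<rbrakk> \<Longrightarrow> diameter (F k a) \<le> r k"
    and gauge: "\<And>k. K \<le> k \<Longrightarrow> (\<Sum>a\<in>H k. hausdorff_gauge s (F k a)) \<le> ennreal (c k)"
    and A: "\<And>k0. A \<subseteq> (\<Union>k\<in>{k0..}. \<Union>a\<in>H k. F k a)"
  shows "hausdorff_measure s A = 0"
proof -
  have bound: "hausdorff_premeasure s \<delta> A \<le> ennreal \<epsilon>" if \<delta>: "0 < \<delta>" and \<epsilon>: "0 < \<epsilon>" for \<delta> \<epsilon> :: real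
  proof -
    have "eventually (\<lambda>k. r k < \<delta>) sequentially" using order_tendstoD(2)[OF r \<delta>] .
    then obtain k1 where k1: "\<And>k. k1 \<le> k \<Longrightarrow> r k < \<delta>" by (auto simp: eventually_sequentially)
    obtain k2 where k2: "\<And>n. k2 \<le> n \<Longrightarrow> norm (\<Sum>i. c (i + n)) < \<epsilon>"
      using suminf_exist_split[OF \<epsilon> c(1)] by auto
    define k0 where "k0 = Max {K, k1, k2}"
    have k0: "K \<le> k0" "k1 \<le> k0" "k2 \<le> k0" by (auto simp: k0_def)
    \<comment> \<open>The finite families from \<open>k0\<close> on are padded with empty sets,
      whose gauge is 0, so that pairs of naturals enumerate the cover.\<close>
    define V where "V = (\<lambda>(k, a). if a \<in> H (k + k0) then F (k + k0) a else {})"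
    define U where "U i = V (prod_decode i)" for i
    have sub: "A \<subseteq> (\<Union>i. U i)"
    proof
      fix x assume "x \<in> A"
      then obtain k a where ka: "k0 \<le> k" "a \<in> H k" "x \<in> F k a" using A[of k0] by auto
      then have "x \<in> U (prod_encode (k - k0, a))" by (simp add: U_def V_def)
      then show "x \<in> (\<Union>i. U i)" by blast
    qed
    have small: "bounded (U i) \<and> diameter (U i) \<le> \<delta>" for i
    proof -
      obtain k a where "prod_decode i = (k, a)" by (cases "prod_decode i")
      moreover have "diameter (F (k + k0) a) \<le> \<delta>" if "a \<in> H (k + k0)"
        using F(2)[OF _ that] k1[of "k + k0"] k0 by fastforce
      ultimately show ?thesis
        using F(1)[of "k + k0" a] k0 \<delta> by (cases "a \<in> H (k + k0)") (simp_all add: U_def V_def)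
    qed
    have "(\<Sum>i. hausdorff_gauge s (U i)) = (\<Sum>k. \<Sum>a. hausdorff_gauge s (V (k, a)))"
      unfolding U_def by (rule suminf_ennreal_2dimen) simp
    also have "\<dots> \<le> (\<Sum>k. ennreal (c (k + k0)))"
    proof (intro suminf_le summableI)
      fix k
      have "(\<Sum>a. hausdorff_gauge s (V (k, a))) = (\<Sum>a\<in>H (k + k0). hausdorff_gauge s (V (k, a)))"
        by (intro suminf_finite H) (auto simp: V_def hausdorff_gauge_def)
      also have "\<dots> = (\<Sum>a\<in>H (k + k0). hausdorff_gauge s (F (k + k0) a))"
        by (intro sum.cong refl) (auto simp: V_def)
      also have "\<dots> \<le> ennreal (c (k + k0))" using gauge k0 by simp
      finally show "(\<Sum>a. hausdorff_gauge s (V (k, a))) \<le> ennreal (c (k + k0))" .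
    qed
    also have "\<dots> = ennreal (\<Sum>k. c (k + k0))"
      using c by (intro suminf_ennreal2) (auto simp: summable_iff_shift)
    also have "\<dots> \<le> ennreal \<epsilon>"
      using k2[OF k0(3)] by (intro ennreal_leI) auto
    finally have "(\<Sum>i. hausdorff_gauge s (U i)) \<le> ennreal \<epsilon>" .
    moreover have "hausdorff_premeasure s \<delta> A \<le> (\<Sum>i. hausdorff_gauge s (U i))"
      unfolding hausdorff_premeasure_def using sub small by (intro INF_lower) auto
    ultimately show ?thesis by (rule order_trans[rotated])
  qed
  have "hausdorff_premeasure s \<delta> A \<le> 0" if "0 < \<delta>" for \<delta>
    by (rule ennreal_le_epsilon) (simp add: bound that)
  then have "hausdorff_measure s A \<le> 0"
    unfolding hausdorff_measure_def by (intro SUP_least) auto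
  then show ?thesis by simp
qed

section \<open>The lower bound for the dimension of the Cantor set\<close>

lemma powr_log_15_14: "(15 ^ N) powr log 15 14 = (14 ^ N :: real)"
proof -
  have "(15 ^ N :: real) powr log 15 14 = 15 powr (log 15 14 * real N)"
    by (simp add: powr_powr mult.commute flip: powr_realpow)
  also have "\<dots> = (15 powr log 15 14) powr real N" by (simp only: powr_powr)
  also have "(15 :: real) powr log 15 14 = 14" by simp
  finally show ?thesis by (simp add: powr_realpow)
qed

text \<open>An arbitrary \<open>U\<close> is enlarged to a Borel interval of radius
  \<open>d = diameter U\<close> about one of its points. If
  \<open>1 / 15 ^ (N+1) \<le> d \<le> 1 / 15 ^ N\<close>, its mass is at most
  \<open>4 / 14 ^ N = 56 / 14 ^ (N+1)\<close>, hence at most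
  \<open>56 * d powr log 15 14\<close>.\<close>

lemma cantor15_mass_distribution:
  assumes U: "bounded U" "diameter U \<le> 1" and s: "0 \<le> s" "s \<le> log 15 14"
  shows "\<exists>V\<in>sets borel. U \<subseteq> V \<and> emeasure cantor15_measure V \<le> 56 * hausdorff_gauge s U"
proof (cases "U = {}")
  case True
  then show ?thesis by (intro bexI[of _ "{}"]) auto
next
  case False
  then obtain x where x: "x \<in> U" by blast
  define d where "d = diameter U"
  define V where "V = {x - d..x + d}"
  interpret prob_space cantor15_measure by (rule prob_space_cantor15_measure)
  have d: "0 \<le> d" "d \<le> 1" using diameter_ge_0[OF U(1)] U by (auto simp: d_def)
  have "U \<subseteq> V"
  proof
    fix y assume "y \<in> U"
    then have "dist x y \<le> d" unfolding d_def by (intro diameter_bounded_bound U x)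
    then show "y \<in> V" by (auto simp: V_def dist_real_def abs_le_iff)
  qed
  moreover have small: "emeasure cantor15_measure V \<le> ennreal (4 / 14 ^ N)" if "d \<le> 1 / 15 ^ N" for N
    unfolding V_def using that by (intro emeasure_cantor15_small_interval_le) auto
  have "emeasure cantor15_measure V \<le> 56 * hausdorff_gauge s U"
  proof (cases "s = 0")
    case True
    have "emeasure cantor15_measure V \<le> 1" using emeasure_le_1 .
    also have "(1::ennreal) \<le> 56" by simp
    finally show ?thesis using True False by (simp add: hausdorff_gauge_def)
  next
    case s0: False
    show ?thesis
    \<comment> \<open>For a single point the gauge is 0, so the point must be shown to carry no
      mass; this follows by letting the level tend to infinity.\<close>
    proof (cases "d = 0")
      case True
      have "(\<lambda>N. 4 / 14 ^ N :: real) \<longlonglongrightarrow> 0" by (rule LIMSEQ_divide_realpow_zero) simp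
      then have "(\<lambda>N. ennreal (4 / 14 ^ N)) \<longlonglongrightarrow> ennreal 0" by (rule tendsto_ennrealI)
      then have "emeasure cantor15_measure V \<le> ennreal 0"
        by (rule LIMSEQ_le_const) (use small True in auto)
      then show ?thesis by simp
    next
      case False
      then have d0: "0 < d" using d by simp
      then obtain n where "(1 / 15) ^ n < d" using real_arch_pow_inv[of d "1 / 15"] by auto
      \<comment> \<open>The least such exponent is nonzero because \<open>d \<le> 1\<close>; its
        predecessor is the level \<open>N\<close> used for the mass bound.\<close>
      then have n: "(1 / 15) ^ (LEAST n. (1 / 15) ^ n < d) < d" by (rule LeastI)
      then have "(LEAST n. (1 / 15) ^ n < d) \<noteq> 0" using d by (metis power_0 not_less)
      then obtain N where N: "(LEAST n. (1 / 15) ^ n < d) = Suc N" using not0_implies_Suc by blast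
      have lo: "1 / 15 ^ Suc N \<le> d" using n unfolding N by (simp add: power_one_over)
      have "\<not> (1 / 15) ^ N < d" using not_less_Least[of N "\<lambda>n. (1 / 15) ^ n < d"] N by simp
      then have hi: "d \<le> 1 / 15 ^ N" by (simp add: power_one_over)
      have "4 / 14 ^ N = 56 * (1 / 15 ^ Suc N) powr log 15 14"
        using powr_log_15_14[of "Suc N"] by (simp add: powr_divide)
      also have "\<dots> \<le> 56 * d powr log 15 14"
        using lo s by (intro mult_left_mono powr_mono2) auto
      also have "\<dots> \<le> 56 * d powr s"
        using d s by (intro mult_left_mono powr_mono') auto
      finally have "ennreal (4 / 14 ^ N) \<le> ennreal (56 * d powr s)" by (rule ennreal_leI)
      also have "\<dots> = 56 * hausdorff_gauge s U"
        using s0 \<open>U \<noteq> {}\<close> by (simp add: hausdorff_gauge_def d_def ennreal_mult)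
      finally show ?thesis using small[OF hi] by (rule order_trans[rotated])
    qed
  qed
  ultimately show ?thesis by (intro bexI[of _ V]) (auto simp: V_def)
qed

lemma hausdorff_dim_cantor15_ge: "ereal (log 15 14) \<le> hausdorff_dim cantor15_set"
  unfolding hausdorff_dim_def
proof (intro INF_greatest)
  fix s assume "s \<in> {s. 0 \<le> s \<and> hausdorff_measure s cantor15_set = 0}"
  then have s: "0 \<le> s" and null: "hausdorff_measure s cantor15_set = 0" by auto
  show "ereal (log 15 14) \<le> ereal s"
  proof (rule ccontr)
    assume "\<not> ereal (log 15 14) \<le> ereal s"
    then have sl: "s \<le> log 15 14" by simp
    have "hausdorff_premeasure s 1 cantor15_set \<le> hausdorff_measure s cantor15_set"
      unfolding hausdorff_measure_def by (intro SUP_upper) auto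
    \<comment> \<open>With the constant 56 of the mass bound, a cover of total gauge below 1/112
      would have mass at most 1/2, although the set has mass 1.\<close>
    with null have "hausdorff_premeasure s 1 cantor15_set < ennreal (1 / 112)" by simp
    then obtain U where sub: "cantor15_set \<subseteq> (\<Union>i. U i)"
      and U: "\<And>i. bounded (U i)" "\<And>i. diameter (U i) \<le> 1"
      and sum: "(\<Sum>i. hausdorff_gauge s (U i)) < ennreal (1 / 112)"
      unfolding hausdorff_premeasure_def INF_less_iff by auto
    have "\<forall>i. \<exists>V. V \<in> sets borel \<and> U i \<subseteq> V \<and> emeasure cantor15_measure V \<le> 56 * hausdorff_gauge s (U i)"
      using cantor15_mass_distribution[OF U s sl] by blast
    then obtain V where V: "\<And>i. V i \<in> sets borel" "\<And>i. U i \<subseteq> V i"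
      "\<And>i. emeasure cantor15_measure (V i) \<le> 56 * hausdorff_gauge s (U i)"
      by metis
    have "1 = emeasure cantor15_measure cantor15_set" by (simp add: emeasure_cantor15_set)
    also have "\<dots> \<le> emeasure cantor15_measure (\<Union>i. V i)"
      using sub V by (intro emeasure_mono) (auto, blast)
    also have "\<dots> \<le> (\<Sum>i. emeasure cantor15_measure (V i))"
      using V by (intro emeasure_subadditive_countably) auto
    also have "\<dots> \<le> (\<Sum>i. 56 * hausdorff_gauge s (U i))" using V by (intro suminf_le summableI) auto
    also have "\<dots> = 56 * (\<Sum>i. hausdorff_gauge s (U i))" by (rule ennreal_suminf_cmult)
    also have "\<dots> \<le> 56 * ennreal (1 / 112)" using sum by (intro mult_left_mono) auto
    also have "\<dots> = ennreal (1 / 2)" by (simp flip: ennreal_numeral ennreal_mult)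
    also have "\<dots> < ennreal 1" by (rule ennreal_lessI) auto
    finally show False by simp
  qed
qed

section \<open>Dyadic blocks of denominators\<close>

text \<open>Recasts the count in terms of \<open>\<delta>\<close> alone, with
  \<open>Q = 2 ^ (k+1)\<close>, \<open>M\<close> the integer part of
  \<open>1 / (12 * \<delta>)\<close> and \<open>N\<close> the least level allowed. The two bounds on
  \<open>15 ^ N\<close> later control the size of the covering intervals.\<close>

lemma cantor15_block_bound:
  obtains \<nu>\<^sub>0 C :: real where "1 < \<nu>\<^sub>0" "0 < C"
    "\<And>k \<delta> \<gamma>. \<lbrakk>0 < \<delta>; \<delta> \<le> 1 / 12; 2 powr (- \<nu>\<^sub>0 * real k) \<le> \<delta>\<rbrakk> \<Longrightarrow>
      \<exists>N. 2 ^ k \<le> (15 ^ N :: real) \<and> 15 ^ N \<le> 30 * 2 ^ k / \<delta> \<and>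
          real (card (cantor15_hits N \<delta> \<gamma> (2 ^ Suc k))) \<le> C * 14 ^ N * (2 ^ k * \<delta>)"
proof -
  obtain \<nu>\<^sub>0 C :: real where \<nu>: "1 < \<nu>\<^sub>0" and C: "0 < C"
    and bound: "\<And>N M \<delta> \<gamma> Q. \<lbrakk>1 \<le> M; 1 \<le> Q; \<delta> \<le> 1 / (12 * real M); 12 * Q * M \<le> 15 ^ N;
      15 ^ N \<le> 180 * Q * M; real M \<le> real Q powr \<nu>\<^sub>0\<rbrakk>
      \<Longrightarrow> real (card (cantor15_hits N \<delta> \<gamma> Q)) \<le> C * 14 ^ N * real Q / real M"
    using cantor15_hits_bound by blast
  have "\<exists>N. 2 ^ k \<le> (15 ^ N :: real) \<and> 15 ^ N \<le> 30 * 2 ^ k / \<delta> \<and>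
          real (card (cantor15_hits N \<delta> \<gamma> (2 ^ Suc k))) \<le> 48 * C * 14 ^ N * (2 ^ k * \<delta>)"
    if \<delta>: "0 < \<delta>" "\<delta> \<le> 1 / 12" "2 powr (- \<nu>\<^sub>0 * real k) \<le> \<delta>" for k :: nat and \<delta> \<gamma> :: real
  proof -
    define Q :: nat where "Q = 2 ^ Suc k"
    define M where "M = nat \<lfloor>1 / (12 * \<delta>)\<rfloor>"
    have ge1: "1 \<le> 1 / (12 * \<delta>)" using \<delta> by (simp add: field_simps)
    then have M1: "1 \<le> M" unfolding M_def by linarith
    have Mup: "real M \<le> 1 / (12 * \<delta>)" using ge1 unfolding M_def by linarith
    have "1 / (12 * \<delta>) \<le> real M + 1" unfolding M_def by linarith
    \<comment> \<open>As \<open>M \<ge> 1\<close>, rounding down costs at most a factor 2.\<close>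
    then have Mlo: "1 / (12 * \<delta>) \<le> 2 * real M" using M1 by linarith
    have MQ: "real M \<le> real Q powr \<nu>\<^sub>0"
    proof -
      have "real M \<le> 1 / \<delta>" using Mup \<delta> by (simp add: field_simps)
      also have "\<dots> \<le> 1 / 2 powr (- \<nu>\<^sub>0 * real k)" using \<delta> by (intro divide_left_mono) auto
      also have "\<dots> = (2 powr real k) powr \<nu>\<^sub>0" by (simp add: powr_powr powr_minus_divide mult.commute)
      also have "\<dots> \<le> real Q powr \<nu>\<^sub>0" using \<nu> by (intro powr_mono2) (auto simp: Q_def powr_realpow)
      finally show ?thesis .
    qed
    \<comment> \<open>The least power of 15 that reaches \<open>12 * Q * M\<close> overshoots by
      less than a factor 15, whence \<open>180 = 12 * 15\<close>.\<close>
    have "2 \<le> 12 * Q * M" using M1 by (simp add: Q_def)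
    then obtain n where n: "15 ^ n < 12 * Q * M" "12 * Q * M \<le> 15 ^ (n + 1)"
      using ex_power_ivl2[of 15 "12 * Q * M"] by auto
    define N where "N = n + 1"
    have lo: "12 * Q * M \<le> 15 ^ N" and hi: "15 ^ N \<le> 180 * Q * M"
      using n by (simp_all add: N_def ac_simps)
    have "\<delta> \<le> 1 / (12 * real M)" using Mup M1 \<delta> by (simp add: field_simps)
    then have card: "real (card (cantor15_hits N \<delta> \<gamma> Q)) \<le> C * 14 ^ N * real Q / real M"
      using M1 lo hi MQ by (intro bound) (auto simp: Q_def)
    have "1 / real M \<le> 24 * \<delta>" using Mlo M1 \<delta> by (simp add: field_simps)
    then have "C * 14 ^ N * real Q * (1 / real M) \<le> C * 14 ^ N * real Q * (24 * \<delta>)"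
      using C by (intro mult_left_mono) auto
    with card have "real (card (cantor15_hits N \<delta> \<gamma> (2 ^ Suc k))) \<le> 48 * C * 14 ^ N * (2 ^ k * \<delta>)"
      by (simp add: Q_def mult_ac)
    moreover have "2 ^ k \<le> (15 ^ N :: real)"
    proof -
      have "2 ^ k * 1 \<le> Q * M" using M1 by (intro mult_le_mono) (auto simp: Q_def)
      with lo have "2 ^ k \<le> (15 ^ N :: nat)" by linarith
      then have "real (2 ^ k) \<le> real (15 ^ N)" by (simp only: of_nat_le_iff)
      then show ?thesis by simp
    qed
    moreover have "15 ^ N \<le> 30 * 2 ^ k / \<delta>"
    proof -
      have "real (15 ^ N) \<le> real (180 * Q * M)" using hi by (simp only: of_nat_le_iff)
      also have "\<dots> = 360 * 2 ^ k * real M" by (simp add: Q_def)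
      also have "\<dots> \<le> 360 * 2 ^ k * (1 / (12 * \<delta>))" using Mup by (intro mult_left_mono) auto
      finally show ?thesis by simp
    qed
    ultimately show ?thesis by blast
  qed
  moreover have "0 < 48 * C" using C by simp
  ultimately show thesis using that \<nu> by blast
qed

text \<open>A solution \<open>q \<ge> 2 ^ k0\<close> exists, and its dyadic block then has index at
  least \<open>k0\<close>.\<close>

lemma approximable_set_blocks:
  assumes x: "x \<in> approximable_set \<psi> \<gamma>"
    and \<psi>: "\<And>k q. \<lbrakk>2 ^ k \<le> q; q < 2 ^ Suc k\<rbrakk> \<Longrightarrow> \<psi> q \<le> \<delta> k"
  shows "\<exists>k\<ge>k0. \<exists>q\<in>{2 ^ k..<2 ^ Suc k}. infdist (real q * x - \<gamma>) \<int> \<le> \<delta> k"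
proof -
  obtain q where q: "2 ^ k0 \<le> q" "1 \<le> q" "infdist (real q * x - \<gamma>) \<int> \<le> \<psi> q"
    using x unfolding approximable_set_def infinite_nat_iff_unbounded_le by auto
  obtain k where k: "2 ^ k \<le> q" "q < 2 ^ Suc k" using ex_power_ivl1[of 2 q] q by auto
  have "(2::nat) ^ k0 < 2 ^ Suc k" using q k by linarith
  then have "k0 < Suc k" by (rule power_less_imp_less_exp[rotated]) simp
  then show ?thesis using k q \<psi>[OF k] by (intro exI[of _ k]) (auto intro!: bexI[of _ q])
qed

lemma cantor15_hitsI:
  assumes "a \<in> cantor15_ints N" "x \<in> cantor15_interval N a" "q \<in> {2 ^ k..<2 ^ Suc k}"
    "infdist (real q * x - \<gamma>) \<int> \<le> \<delta>"
  shows "a \<in> cantor15_hits N \<delta> \<gamma> (2 ^ Suc k)"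
proof -
  have "1 \<le> (2::nat) ^ k" by simp
  then have "q \<in> {1..2 ^ Suc k}" using assms(3) by (auto intro: order_trans)
  with assms show ?thesis unfolding cantor15_hits_def by blast
qed

lemma finite_cantor15_hits [simp]: "finite (cantor15_hits N \<delta> \<gamma> Q)"
  by (simp add: cantor15_hits_def)

section \<open>The convergence statement and the dimension bound\<close>

lemma closed_infdist_le: "closed {x::real. infdist (real q * x - \<gamma>) \<int> \<le> c}"
  by (intro closed_Collect_le continuous_intros)

lemma approximable_set_borel: "approximable_set \<psi> \<gamma> \<in> sets borel"
proof -
  have "approximable_set \<psi> \<gamma>
      = (\<Inter>m. \<Union>q\<in>{q. m \<le> q \<and> 1 \<le> q}. {x. infdist (real q * x - \<gamma>) \<int> \<le> \<psi> q})"
    by (auto simp: approximable_set_def infinite_nat_iff_unbounded_le)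
  also have "\<dots> \<in> sets borel"
    by (intro sets.countable_INT'' sets.countable_UN') (auto intro: borel_closed closed_infdist_le)
  finally show ?thesis .
qed

text \<open>Borel-Cantelli over dyadic blocks: block \<open>k\<close> has measure at most a constant
  times \<open>2 ^ k * \<delta> k\<close>, and these bounds are summable by Cauchy
  condensation.\<close>

lemma cantor15_null_approximable:
  fixes \<psi> :: "nat \<Rightarrow> real"
  assumes pos: "\<And>q. 1 \<le> q \<Longrightarrow> 0 < \<psi> q"
    and mono: "antimono_on {1..} \<psi>"
    and summable: "summable (\<lambda>q. \<psi> (Suc q))"
  shows "approximable_set \<psi> \<gamma> \<in> null_sets cantor15_measure"
proof -
  interpret prob_space cantor15_measure by (rule prob_space_cantor15_measure)
  obtain \<nu>\<^sub>0 C :: real where \<nu>\<^sub>0: "1 < \<nu>\<^sub>0" and C: "0 < C"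
    and block: "\<And>k \<delta> \<gamma>. \<lbrakk>0 < \<delta>; \<delta> \<le> 1 / 12; 2 powr (- \<nu>\<^sub>0 * real k) \<le> \<delta>\<rbrakk> \<Longrightarrow>
      \<exists>N. 2 ^ k \<le> (15 ^ N :: real) \<and> 15 ^ N \<le> 30 * 2 ^ k / \<delta> \<and>
          real (card (cantor15_hits N \<delta> \<gamma> (2 ^ Suc k))) \<le> C * 14 ^ N * (2 ^ k * \<delta>)"
    using cantor15_block_bound by blast
  \<comment> \<open>Enlarging the radius to \<open>2 powr (- \<nu>\<^sub>0 * k)\<close> meets the
    lower bound demanded by the block count, and \<open>\<nu>\<^sub>0 > 1\<close> keeps
    \<open>2 ^ k * \<delta> k\<close> summable.\<close>
  define \<delta> where "\<delta> k = max (\<psi> (2 ^ k)) (2 powr (- \<nu>\<^sub>0 * real k))" for k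
  have \<delta>_pos: "0 < \<delta> k" for k by (simp add: \<delta>_def less_max_iff_disj)
  have "summable (\<lambda>k. 2 ^ k * \<psi> (2 ^ k))"
  proof -
    \<comment> \<open>The value of \<open>\<psi>\<close> at 0 is unconstrained; setting it to 0
      makes the function nonnegative everywhere, as condensation requires.\<close>
    define f where "f n = (if n = 0 then 0 else \<psi> n)" for n
    have "summable f" using summable by (subst summable_Suc_iff[symmetric]) (simp add: f_def)
    moreover have "f (Suc m) \<le> f m" if "0 < m" for m
      using that monotone_onD[OF mono, of m "Suc m"] by (simp add: f_def)
    moreover have "0 \<le> f n" for n using pos[of n] by (cases n) (auto simp: f_def)
    ultimately show ?thesis using condensation_test[of f] by (simp add: f_def)
  qed
  moreover have "summable (\<lambda>k. 2 ^ k * 2 powr (- \<nu>\<^sub>0 * real k))"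
  proof -
    have "2 ^ k * 2 powr (- \<nu>\<^sub>0 * real k) = (2 powr (1 - \<nu>\<^sub>0)) ^ k" for k
      by (simp add: powr_powr algebra_simps flip: powr_realpow powr_add)
    moreover have "2 powr (1 - \<nu>\<^sub>0) < 1" using \<nu>\<^sub>0 powr_less_one[of 2 "1 - \<nu>\<^sub>0"] by simp
    ultimately show ?thesis by (simp add: summable_geometric)
  qed
  ultimately have "summable (\<lambda>k. 2 ^ k * \<psi> (2 ^ k) + 2 ^ k * 2 powr (- \<nu>\<^sub>0 * real k))"
    by (rule summable_add)
  then have sum\<delta>: "summable (\<lambda>k. 2 ^ k * \<delta> k)"
  proof (rule summable_comparison_test'[where N = 0])
    fix k
    have "0 < \<psi> (2 ^ k)" by (intro pos) simp
    then have "\<delta> k \<le> \<psi> (2 ^ k) + 2 powr (- \<nu>\<^sub>0 * real k)" by (simp add: \<delta>_def)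
    then have "2 ^ k * \<delta> k \<le> 2 ^ k * (\<psi> (2 ^ k) + 2 powr (- \<nu>\<^sub>0 * real k))"
      by (intro mult_left_mono) auto
    then show "norm (2 ^ k * \<delta> k) \<le> 2 ^ k * \<psi> (2 ^ k) + 2 ^ k * 2 powr (- \<nu>\<^sub>0 * real k)"
      using \<delta>_pos[of k] by (simp add: abs_mult distrib_left)
  qed
  have "(\<lambda>k. 2 ^ k * \<delta> k) \<longlonglongrightarrow> 0" using sum\<delta> by (rule summable_LIMSEQ_zero)
  then have "eventually (\<lambda>k. 2 ^ k * \<delta> k < 1 / 12) sequentially"
    by (rule order_tendstoD) simp
  then obtain K where K: "\<And>k. K \<le> k \<Longrightarrow> 2 ^ k * \<delta> k < 1 / 12"
    by (auto simp: eventually_sequentially)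
  have small: "\<delta> k \<le> 1 / 12" if "K \<le> k" for k
  proof -
    have "1 * \<delta> k \<le> 2 ^ k * \<delta> k" using \<delta>_pos[of k] by (intro mult_right_mono) auto
    then show ?thesis using K[OF that] by simp
  qed
  \<comment> \<open>The index is shifted by \<open>K\<close> so that every block satisfies
    \<open>\<delta> \<le> 1 / 12\<close>.\<close>
  define A where "A k = (\<Union>q\<in>{2 ^ (k + K)..<2 ^ Suc (k + K)}. {x. infdist (real q * x - \<gamma>) \<int> \<le> \<delta> (k + K)})" for k
  have A: "A k \<in> sets borel" for k
    unfolding A_def by (intro borel_closed closed_UN) (auto intro: closed_infdist_le)
  have A_le: "measure cantor15_measure (A k) \<le> C * (2 ^ (k + K) * \<delta> (k + K))" for k
  proof -
    let ?k = "k + K"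
    have "2 powr (- \<nu>\<^sub>0 * real ?k) \<le> \<delta> ?k" by (simp add: \<delta>_def)
    then obtain N where N: "real (card (cantor15_hits N (\<delta> ?k) \<gamma> (2 ^ Suc ?k))) \<le> C * 14 ^ N * (2 ^ ?k * \<delta> ?k)"
      using block[of "\<delta> ?k" ?k \<gamma>] \<delta>_pos[of ?k] small[of ?k] by auto
    have "{a \<in> cantor15_ints N. cantor15_interval N a \<inter> A k \<noteq> {}} \<subseteq> cantor15_hits N (\<delta> ?k) \<gamma> (2 ^ Suc ?k)"
      unfolding A_def using cantor15_hitsI[where k = ?k and \<delta> = "\<delta> ?k" and \<gamma> = \<gamma>] by blast
    then have "card {a \<in> cantor15_ints N. cantor15_interval N a \<inter> A k \<noteq> {}}
        \<le> card (cantor15_hits N (\<delta> ?k) \<gamma> (2 ^ Suc ?k))"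
      by (intro card_mono) auto
    with N have "real (card {a \<in> cantor15_ints N. cantor15_interval N a \<inter> A k \<noteq> {}}) / 14 ^ N
        \<le> C * (2 ^ ?k * \<delta> ?k)"
      by (simp add: field_simps)
    with emeasure_cantor15_le[OF A[of k], of N]
    have "emeasure cantor15_measure (A k) \<le> ennreal (C * (2 ^ ?k * \<delta> ?k))"
      by (meson ennreal_leI order_trans)
    then show ?thesis
      using C \<delta>_pos[of ?k] by (simp add: emeasure_eq_measure)
  qed
  have "limsup A \<in> null_sets cantor15_measure"
  proof (rule borel_cantelli_limsup1)
    show "summable (\<lambda>k. measure cantor15_measure (A k))"
    proof (rule summable_comparison_test')
      show "summable (\<lambda>k. C * (2 ^ (k + K) * \<delta> (k + K)))"
        using sum\<delta> by (intro summable_mult) (subst summable_iff_shift)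
      show "norm (measure cantor15_measure (A k)) \<le> C * (2 ^ (k + K) * \<delta> (k + K))" if "0 \<le> k" for k
        using A_le by simp
    qed
  qed (use A in \<open>auto simp: emeasure_eq_measure\<close>)
  moreover have "approximable_set \<psi> \<gamma> \<subseteq> limsup A"
  proof
    fix x assume x: "x \<in> approximable_set \<psi> \<gamma>"
    have "\<psi> q \<le> \<delta> k" if "2 ^ k \<le> q" for k q
    proof -
      have "1 \<le> (2::nat) ^ k" by simp
      moreover from this that have "1 \<le> q" by (rule order_trans)
      ultimately have "\<psi> q \<le> \<psi> (2 ^ k)" using that by (intro monotone_onD[OF mono]) auto
      then show ?thesis by (simp add: \<delta>_def)
    qed
    then have *: "\<exists>k\<ge>n + K. \<exists>q\<in>{2 ^ k..<2 ^ Suc k}. infdist (real q * x - \<gamma>) \<int> \<le> \<delta> k" for n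
      using approximable_set_blocks[OF x, of \<delta>] by blast
    have "\<exists>m\<ge>n. x \<in> A m" for n
    proof -
      obtain k q where "n + K \<le> k" "q \<in> {2 ^ k..<2 ^ Suc k}" "infdist (real q * x - \<gamma>) \<int> \<le> \<delta> k"
        using * by blast
      then have "n \<le> k - K" "x \<in> A (k - K)" by (auto simp: A_def)
      then show ?thesis by blast
    qed
    then show "x \<in> limsup A" by (auto simp: limsup_INF_SUP)
  qed
  ultimately show ?thesis
    using approximable_set_borel by (auto intro: null_sets_subset)
qed

section \<open>The upper bound for the dimension of the approximable points\<close>

lemma log_15_14_bounds: "1 / 2 \<le> log 15 14" "log 15 14 < (1 :: real)"
proof -
  have "1 = log 15 (15 :: real)" by simp
  also have "\<dots> \<le> log 15 (14 ^ 2)" by (subst log_le_cancel_iff) auto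
  also have "\<dots> = 2 * log 15 14" using log_nat_power[of 14 15 2] by simp
  finally show "1 / 2 \<le> log 15 (14 :: real)" by simp
qed simp

lemma hausdorff_gauge_cantor15_interval:
  assumes "0 < s"
  shows "hausdorff_gauge s (cantor15_interval N a) = ennreal ((15 ^ N) powr (- s))"
    and "diameter (cantor15_interval N a) = 1 / 15 ^ N"
proof -
  have le: "real a / 15 ^ N \<le> (real a + 1) / 15 ^ N" by (intro divide_right_mono) auto
  then show d: "diameter (cantor15_interval N a) = 1 / 15 ^ N"
    unfolding cantor15_interval_def by (simp add: diameter_closed_interval add_divide_distrib)
  have "cantor15_interval N a \<noteq> {}" using le by (auto simp: cantor15_interval_def)
  then show "hausdorff_gauge s (cantor15_interval N a) = ennreal ((15 ^ N) powr (- s))"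
    using assms by (simp add: hausdorff_gauge_def d powr_divide powr_minus_divide)
qed

text \<open>In block \<open>k\<close> the hit intervals have total gauge at most a constant times
  \<open>2 ^ k * \<delta> k * (15 ^ N) powr (L - s)\<close>. With
  \<open>15 ^ N \<le> 30 * 2 ^ k / \<delta> k\<close> this decays geometrically in \<open>k\<close>
  as soon as \<open>s\<close> exceeds the claimed bound.\<close>

lemma hausdorff_dim_cantor15_approximable_le:
  obtains c :: real where "0 < c"
    "\<And>\<nu> \<gamma>. \<lbrakk>1 < \<nu>; \<nu> < 1 + c\<rbrakk> \<Longrightarrow>
      hausdorff_dim (cantor15_set \<inter> approximable_set (\<lambda>q. real q powr (- \<nu>)) \<gamma>)
        \<le> ereal (2 / (\<nu> + 1) + log 15 14 - 1)"
proof -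
  obtain \<nu>\<^sub>0 C :: real where \<nu>\<^sub>0: "1 < \<nu>\<^sub>0" and C: "0 < C"
    and block: "\<And>k \<delta> \<gamma>. \<lbrakk>0 < \<delta>; \<delta> \<le> 1 / 12; 2 powr (- \<nu>\<^sub>0 * real k) \<le> \<delta>\<rbrakk> \<Longrightarrow>
      \<exists>N. 2 ^ k \<le> (15 ^ N :: real) \<and> 15 ^ N \<le> 30 * 2 ^ k / \<delta> \<and>
          real (card (cantor15_hits N \<delta> \<gamma> (2 ^ Suc k))) \<le> C * 14 ^ N * (2 ^ k * \<delta>)"
    using cantor15_block_bound by blast
  define L where "L = log 15 (14 :: real)"
  have bound: "hausdorff_dim (cantor15_set \<inter> approximable_set (\<lambda>q. real q powr (- \<nu>)) \<gamma>)
        \<le> ereal (2 / (\<nu> + 1) + L - 1)"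
    \<comment> \<open>Here \<open>\<nu> < \<nu>\<^sub>0\<close> admits the block count, and
      \<open>\<nu> < 2\<close> makes \<open>v\<close> positive, since then
      \<open>v > 2 / 3 + 1 / 2 - 1\<close>.\<close>
    if \<nu>: "1 < \<nu>" "\<nu> < 1 + min (\<nu>\<^sub>0 - 1) 1" for \<nu> \<gamma> :: real
  proof -
    let ?A = "cantor15_set \<inter> approximable_set (\<lambda>q. real q powr (- \<nu>)) \<gamma>"
    define v where "v = 2 / (\<nu> + 1) + L - 1"
    have "2 / 3 < 2 / (\<nu> + 1)" "2 / (\<nu> + 1) < 1" using \<nu> by (auto simp: field_simps)
    then have v: "0 < v" "v < L" using log_15_14_bounds by (auto simp: v_def L_def)
    \<comment> \<open>The restriction \<open>s < L\<close> makes the exponent \<open>L - s\<close>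
      positive, so that the upper bound on \<open>15 ^ N\<close> can be inserted. Such
      \<open>s\<close> exist because \<open>v < L\<close>.\<close>
    have zero: "hausdorff_measure s ?A = 0" if s: "v < s" "s < L" for s
    proof -
      define \<delta> where "\<delta> k = 2 powr (- \<nu> * real k)" for k :: nat
      \<comment> \<open>The growth exponent of the gauge sums in base 2: \<open>1 - \<nu>\<close>
        comes from \<open>2 ^ k * \<delta> k\<close> and \<open>1 + \<nu>\<close> from
        \<open>2 ^ k / \<delta> k\<close>. It vanishes exactly at \<open>s = v\<close>.\<close>
      define \<theta> where "\<theta> = (1 - \<nu>) + (1 + \<nu>) * (L - s)"
      have "(1 + \<nu>) * v < (1 + \<nu>) * s" using s \<nu> by simp
      moreover have "(1 + \<nu>) * v = 2 + (1 + \<nu>) * (L - 1)"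
        using \<nu> by (simp add: v_def field_simps)
      ultimately have \<theta>: "\<theta> < 0" by (simp add: \<theta>_def algebra_simps)
      have \<delta>_pos: "0 < \<delta> k" for k by (simp add: \<delta>_def)
      have \<delta>_pow: "\<delta> k = (2 powr (- \<nu>)) ^ k" for k
        by (simp add: \<delta>_def powr_powr flip: powr_realpow)
      have "(\<lambda>k. (2 powr (- \<nu>)) ^ k) \<longlonglongrightarrow> 0"
        using \<nu> powr_less_one[of 2 "- \<nu>"] by (intro LIMSEQ_realpow_zero) auto
      then have "eventually (\<lambda>k. \<delta> k < 1 / 12) sequentially"
        unfolding \<delta>_pow by (rule order_tendstoD) simp
      then obtain K where K: "\<And>k. K \<le> k \<Longrightarrow> \<delta> k < 1 / 12" by (auto simp: eventually_sequentially)
      have "\<exists>N. K \<le> k \<longrightarrow> 2 ^ k \<le> (15 ^ N :: real) \<and> 15 ^ N \<le> 30 * 2 ^ k / \<delta> k \<and>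
          real (card (cantor15_hits N (\<delta> k) \<gamma> (2 ^ Suc k))) \<le> C * 14 ^ N * (2 ^ k * \<delta> k)" for k
      proof (cases "K \<le> k")
        case True
        have "\<nu> * real k \<le> \<nu>\<^sub>0 * real k" using \<nu> by (intro mult_right_mono) auto
        then have "2 powr (- \<nu>\<^sub>0 * real k) \<le> \<delta> k" unfolding \<delta>_def by (intro powr_mono) auto
        with block[OF \<delta>_pos] K[OF True] show ?thesis by (meson less_imp_le)
      qed simp
      then obtain N where N: "\<And>k. K \<le> k \<Longrightarrow> 2 ^ k \<le> (15 ^ N k :: real)"
        "\<And>k. K \<le> k \<Longrightarrow> 15 ^ N k \<le> 30 * 2 ^ k / \<delta> k"
        "\<And>k. K \<le> k \<Longrightarrow> real (card (cantor15_hits (N k) (\<delta> k) \<gamma> (2 ^ Suc k))) \<le> C * 14 ^ N k * (2 ^ k * \<delta> k)"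
        by metis
      define H where "H k = cantor15_hits (N k) (\<delta> k) \<gamma> (2 ^ Suc k)" for k
      define c where "c k = C * 30 powr (L - s) * (2 powr \<theta>) ^ k" for k :: nat
      show ?thesis
      proof (rule hausdorff_measure_limsup_zero[where H = H and F = "\<lambda>k. cantor15_interval (N k)"
            and c = c and r = "\<lambda>k. 1 / 2 ^ k" and K = K])
        show "finite (H k)" for k by (simp add: H_def)
        show "summable c"
          unfolding c_def using \<theta> powr_less_one[of 2 \<theta>] by (intro summable_mult summable_geometric) auto
        show "0 \<le> c k" for k using C by (simp add: c_def)
        show "(\<lambda>k. 1 / 2 ^ k) \<longlonglongrightarrow> (0::real)" by (rule LIMSEQ_divide_realpow_zero) simp
        show "bounded (cantor15_interval (N k) a)" for k a
          by (simp add: cantor15_interval_def)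
        show "diameter (cantor15_interval (N k) a) \<le> 1 / 2 ^ k" if "K \<le> k" for k a
          using N(1)[OF that] v s by (subst hausdorff_gauge_cantor15_interval) (auto simp: field_simps)
        show "(\<Sum>a\<in>H k. hausdorff_gauge s (cantor15_interval (N k) a)) \<le> ennreal (c k)" if k: "K \<le> k" for k
        proof -
          have 15: "(15 ^ N k) powr L = (14 ^ N k :: real)" unfolding L_def by (rule powr_log_15_14)
          have "real (card (H k)) * (15 ^ N k) powr (- s)
              \<le> C * 14 ^ N k * (2 ^ k * \<delta> k) * (15 ^ N k) powr (- s)"
            using N(3)[OF k] unfolding H_def by (intro mult_right_mono) auto
          also have "\<dots> = C * (2 ^ k * \<delta> k) * (15 ^ N k) powr (L - s)"
            unfolding 15[symmetric] by (simp add: powr_diff powr_minus_divide)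
          also have "\<dots> \<le> C * (2 ^ k * \<delta> k) * (30 * 2 ^ k / \<delta> k) powr (L - s)"
            using N(2)[OF k] C \<delta>_pos[of k] s by (intro mult_left_mono powr_mono2) auto
          also have "\<dots> = c k"
          proof -
            have "2 ^ k * \<delta> k = 2 powr ((1 - \<nu>) * real k)"
              by (simp add: \<delta>_def algebra_simps flip: powr_realpow powr_add)
            moreover have "30 * 2 ^ k / \<delta> k = 30 * 2 powr ((1 + \<nu>) * real k)"
              by (simp add: \<delta>_def powr_minus_divide algebra_simps flip: powr_realpow powr_add)
            moreover have "(2 powr \<theta>) ^ k = 2 powr (\<theta> * real k)"
              by (simp add: powr_powr flip: powr_realpow)
            ultimately show ?thesis
              by (simp add: c_def \<theta>_def powr_mult powr_powr algebra_simps flip: powr_add)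
          qed
          finally have "real (card (H k)) * (15 ^ N k) powr (- s) \<le> c k" .
          moreover have "(\<Sum>a\<in>H k. hausdorff_gauge s (cantor15_interval (N k) a))
              = ennreal (real (card (H k)) * (15 ^ N k) powr (- s))"
            using v s by (simp add: hausdorff_gauge_cantor15_interval ennreal_mult ennreal_of_nat_eq_real_of_nat)
          ultimately show ?thesis by (simp add: ennreal_leI)
        qed
        show "?A \<subseteq> (\<Union>k\<in>{k0..}. \<Union>a\<in>H k. cantor15_interval (N k) a)" for k0
        proof
          fix x assume x: "x \<in> ?A"
          have "real q powr (- \<nu>) \<le> \<delta> k" if "2 ^ k \<le> q" for k q
          proof -
            have "real (2 ^ k) \<le> real q" using that by (simp only: of_nat_le_iff)
            then have "real q powr (- \<nu>) \<le> (2 ^ k) powr (- \<nu>)"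
              using \<nu> by (intro powr_mono2') auto
            also have "\<dots> = \<delta> k" by (simp add: \<delta>_def powr_powr mult.commute flip: powr_realpow)
            finally show ?thesis .
          qed
          then obtain k q where k: "k0 \<le> k" "q \<in> {2 ^ k..<2 ^ Suc k}"
            "infdist (real q * x - \<gamma>) \<int> \<le> \<delta> k"
            using approximable_set_blocks[of x "\<lambda>q. real q powr (- \<nu>)" \<gamma> \<delta> k0] x by auto
          obtain a where a: "a \<in> cantor15_ints (N k)" "x \<in> cantor15_interval (N k) a"
            using cantor15_set_subset x by blast
          then have "a \<in> H k" unfolding H_def using k by (intro cantor15_hitsI)
          with k a show "x \<in> (\<Union>k\<in>{k0..}. \<Union>a\<in>H k. cantor15_interval (N k) a)" by blast
        qed
      qed
    qed
    have "hausdorff_dim ?A \<le> ereal v"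
    proof (rule ccontr)
      assume "\<not> hausdorff_dim ?A \<le> ereal v"
      then have "ereal v < min (hausdorff_dim ?A) (ereal L)" using v by auto
      \<comment> \<open>A real exponent strictly between \<open>v\<close> and the supposed
        dimension, also below \<open>L\<close>, has zero Hausdorff measure and contradicts the
        infimum.\<close>
      then obtain s where s: "ereal v < ereal s" "ereal s < min (hausdorff_dim ?A) (ereal L)"
        using ereal_dense2 by blast
      then have "hausdorff_measure s ?A = 0" by (intro zero) auto
      then have "hausdorff_dim ?A \<le> ereal s"
        unfolding hausdorff_dim_def using s v by (intro INF_lower) auto
      with s show False by auto
    qed
    then show ?thesis by (simp add: v_def)
  qed
  show thesis
    by (rule that[of "min (\<nu>\<^sub>0 - 1) 1"]) (use \<nu>\<^sub>0 bound in \<open>auto simp: L_def\<close>)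
qed

theorem theoremB:
  shows "(\<forall>(\<psi> :: nat \<Rightarrow> real).
            (\<forall>q\<ge>1. 0 < \<psi> q \<and> \<psi> q \<le> 1) \<longrightarrow>
            antimono_on {1..} \<psi> \<longrightarrow>
            summable (\<lambda>q. \<psi> (Suc q)) \<longrightarrow>
            (\<forall>\<gamma>. approximable_set \<psi> \<gamma> \<in> null_sets cantor15_measure)) \<and>
         (\<exists>c>0. \<forall>(\<nu> :: real) \<gamma>. 1 < \<nu> \<and> \<nu> < 1 + c \<longrightarrow>
            hausdorff_dim (cantor15_set \<inter> approximable_set (\<lambda>q. real q powr (- \<nu>)) \<gamma>)
              \<le> ereal (2 / (\<nu> + 1)) + hausdorff_dim cantor15_set - 1)"
proof (intro conjI allI impI)
  fix \<psi> :: "nat \<Rightarrow> real" and \<gamma> :: real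
  assume "\<forall>q\<ge>1. 0 < \<psi> q \<and> \<psi> q \<le> 1" "antimono_on {1..} \<psi>" "summable (\<lambda>q. \<psi> (Suc q))"
  then show "approximable_set \<psi> \<gamma> \<in> null_sets cantor15_measure"
    by (intro cantor15_null_approximable) auto
next
  obtain c :: real where c: "0 < c" and dim: "\<And>\<nu> \<gamma>. \<lbrakk>1 < \<nu>; \<nu> < 1 + c\<rbrakk> \<Longrightarrow>
      hausdorff_dim (cantor15_set \<inter> approximable_set (\<lambda>q. real q powr (- \<nu>)) \<gamma>)
        \<le> ereal (2 / (\<nu> + 1) + log 15 14 - 1)"
    using hausdorff_dim_cantor15_approximable_le by blast
  \<comment> \<open>The dimension of the Cantor set stands on the larger side, so its lower bound
    suffices.\<close>
  have "ereal (2 / (\<nu> + 1) + log 15 14 - 1) \<le> ereal (2 / (\<nu> + 1)) + hausdorff_dim cantor15_set - 1" for \<nu>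
  proof -
    have "ereal (2 / (\<nu> + 1) + log 15 14 - 1) = ereal (2 / (\<nu> + 1)) + ereal (log 15 14) - 1"
      by (simp add: one_ereal_def)
    also have "\<dots> \<le> ereal (2 / (\<nu> + 1)) + hausdorff_dim cantor15_set - 1"
      by (intro ereal_minus_mono add_left_mono hausdorff_dim_cantor15_ge order_refl)
    finally show ?thesis .
  qed
  with c dim show "\<exists>c>0. \<forall>(\<nu> :: real) \<gamma>. 1 < \<nu> \<and> \<nu> < 1 + c \<longrightarrow>
            hausdorff_dim (cantor15_set \<inter> approximable_set (\<lambda>q. real q powr (- \<nu>)) \<gamma>)
              \<le> ereal (2 / (\<nu> + 1)) + hausdorff_dim cantor15_set - 1"
    by (meson order_trans)
qed

end
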